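(* Let $K_1,\dots,K_n$ be convex bodies in $\mathbb{R}^n$ of class $C^2_+$ with centroid at the origin. Let $p\ne-n$ and $s\neq-n$ be real numbers. (i) If $T:\mathbb{R}^n\to\mathbb{R}^n$ is an invertible linear transform, then $$as_{-n}(TK_1,\dots,TK_n)=|\det(T)|\,as_{-n}(K_1,\dots,K_n).$$ In particular, if $|\det(T)|=1$, then $as_{-n}(TK_1,\dots,TK_n)=as_{-n}(K_1,\dots,K_n)$. (ii) For every integer $1\le m\le n$, $$as_{-n}(K_1,\dots,K_n)^m\le\prod_{i=0}^{m-1}as_{-n}(K_1,\dots,K_{n-m},\underbrace{K_{n-i},\dots,K_{n-i}}_m),$$ with equality if the $K_j$, $j=n-m+1,\dots,n$, are dilates of each other. In particular, for $m=n$, $as_{-n}(K_1,\dots,K_n)^n\le as_{-n}(K_1)\cdots as_{-n}(K_n)$. (iii) If $\frac{n(s-p)}{(n+p)(n+s)}\ge0$, then $$as_p(K_1,\dots,K_n)\le\big(as_{-n}(K_1,\dots,K_n)\big)^{\frac{2n(s-p)}{(n+p)(n+s)}}\,as_s(K_1,\dots,K_n).$$ (iv) If $\frac{n(s-p)}{(n+p)(n+s)}\le0$, then $$as_p(K_1,\dots,K_n)\ge\big(as_{-n}(K_1,\dots,K_n)\big)^{\frac{2n(s-p)}{(n+p)(n+s)}}\,as_s(K_1,\dots,K_n).$$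
   Context: $K\in C^2_+$ means that $\partial K$ is of class $C^2$ with everywhere strictly positive Gauss curvature. $h_K$ is the support function of $K$; $f_K(u)$ is the reciprocal of the Gauss curvature of $\partial K$ at the unique boundary point with outer unit normal $u\in S^{n-1}$; $\sigma$ is the surface area measure on $S^{n-1}$. For real $p\ne-n$, $$as_p(K_1,\dots,K_n)=\int_{S^{n-1}}\big[h_{K_1}(u)^{1-p}f_{K_1}(u)\cdots h_{K_n}(u)^{1-p}f_{K_n}(u)\big]^{\frac1{n+p}}\,d\sigma(u),$$ and $$as_{-n}(K_1,\dots,K_n)=\max_{u\in S^{n-1}}\Big[f_{K_1}(u)^{\frac1{2n}}h_{K_1}(u)^{\frac{n+1}{2n}}\cdots f_{K_n}(u)^{\frac1{2n}}h_{K_n}(u)^{\frac{n+1}{2n}}\Big].$$ $as_{-n}(K)=as_{-n}(K,\dots,K)$. Bodies with centroid at the origin are dilates if they are positive multiples of one another. *)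

theory Defs
  imports "HOL-Analysis.Analysis"
begin

definition convex_body :: "(real^'n) set \<Rightarrow> bool" where
  "convex_body K \<longleftrightarrow> convex K \<and> compact K \<and> interior K \<noteq> {}"

definition centroid :: "(real^'n) set \<Rightarrow> real^'n" where
  "centroid K = (LINT x:K|lborel. x) /\<^sub>R measure lborel K"

definition support_function :: "(real^'n) set \<Rightarrow> real^'n \<Rightarrow> real" where
  "support_function K u = (SUP x\<in>K. x \<bullet> u)"

definition outer_unit_normal :: "(real^'n) set \<Rightarrow> real^'n \<Rightarrow> real^'n \<Rightarrow> bool" where
  "outer_unit_normal K x u \<longleftrightarrow> norm u = 1 \<and> (\<forall>y\<in>K. y \<bullet> u \<le> x \<bullet> u)"

text \<open>Only meaningful at boundary points with exactly one outer unit normal; every boundary point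
  of a convex body with differentiable boundary is of this kind.\<close>
definition gauss_map :: "(real^'n) set \<Rightarrow> real^'n \<Rightarrow> real^'n" where
  "gauss_map K x = (THE u. outer_unit_normal K x u)"

text \<open>\<open>G\<close> is the gradient and \<open>H\<close> the Hessian matrix of \<open>F\<close>.\<close>
definition C2_on :: "(real^'n) set \<Rightarrow> (real^'n \<Rightarrow> real) \<Rightarrow> (real^'n \<Rightarrow> real^'n) \<Rightarrow>
    (real^'n \<Rightarrow> real^'n^'n) \<Rightarrow> bool" where
  "C2_on U F G H \<longleftrightarrow>
     (\<forall>y\<in>U. (F has_derivative (\<lambda>v. G y \<bullet> v)) (at y)) \<and>
     (\<forall>y\<in>U. (G has_derivative (\<lambda>v. H y *v v)) (at y)) \<and>
     continuous_on U H"

text \<open>The boundary is locally a regular level set of a \<open>C\<^sup>2\<close> function.\<close>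
definition C2_boundary :: "(real^'n) set \<Rightarrow> bool" where
  "C2_boundary K \<longleftrightarrow>
     (\<forall>x\<in>frontier K. \<exists>U F G H. open U \<and> x \<in> U \<and> C2_on U F G H \<and>
        (\<forall>y\<in>U. G y \<noteq> 0) \<and> frontier K \<inter> U = {y\<in>U. F y = 0})"

text \<open>The determinant of the Weingarten map, i.e. of the differential of the Gauss map on the tangent
  space \<open>u\<^sup>\<bottom>\<close>. The derivative within the frontier is unique only on tangent vectors, so it is
  composed with the projection onto \<open>u\<^sup>\<bottom>\<close>; adding the identity on the normal line leaves the
  determinant unchanged and allows it to be taken on the whole space. For \<open>CARD('n) = 1\<close> the value
  is 1, the empty determinant.\<close>
definition gauss_curvature :: "(real^'n) set \<Rightarrow> real^'n \<Rightarrow> real" where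
  "gauss_curvature K x =
     (let u = gauss_map K x;
          D = frechet_derivative (gauss_map K) (at x within frontier K)
      in det (matrix (\<lambda>v. D (v - (v \<bullet> u) *\<^sub>R u) + (v \<bullet> u) *\<^sub>R u)))"

definition C2_plus :: "(real^'n) set \<Rightarrow> bool" where
  "C2_plus K \<longleftrightarrow> convex_body K \<and> C2_boundary K \<and> (\<forall>x\<in>frontier K. gauss_curvature K x > 0)"

text \<open>The boundary point with outer unit normal \<open>u\<close> is unique if \<open>C2_plus K\<close>.\<close>
definition curvature_function :: "(real^'n) set \<Rightarrow> real^'n \<Rightarrow> real" where
  "curvature_function K u =
     1 / gauss_curvature K (THE x. x \<in> frontier K \<and> outer_unit_normal K x u)"

text \<open>Surface area measure on the unit sphere, by polar coordinates: \<open>\<sigma>(A)\<close> is \<open>n\<close> times the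
  Lebesgue measure of the cone \<open>{r u | u \<in> A, 0 < r \<le> 1}\<close>.\<close>
definition sphere_measure :: "(real^'n) measure" where
  "sphere_measure = scale_measure (of_nat CARD('n))
     (distr (restrict_space lborel (cball 0 1 - {0}))
            (restrict_space borel (sphere 0 1)) (\<lambda>x. x /\<^sub>R norm x))"

text \<open>The bodies \<open>K\<^sub>1, \<dots>, K\<^sub>n\<close> are the values of \<open>K\<close> on \<open>{1..CARD('n)}\<close>; other values are ignored.\<close>
definition mixed_affine_surface_area :: "real \<Rightarrow> (nat \<Rightarrow> (real^'n) set) \<Rightarrow> real" where
  "mixed_affine_surface_area p K =
     (LINT u|sphere_measure.
        (\<Prod>i=1..CARD('n). support_function (K i) u powr (1 - p) * curvature_function (K i) u)
          powr (1 / (real CARD('n) + p)))"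

text \<open>The case \<open>p = -n\<close>; for \<open>C2_plus\<close> bodies with the origin in the interior, the supremum is
  a maximum.\<close>
definition mixed_affine_surface_area_neg_n :: "(nat \<Rightarrow> (real^'n) set) \<Rightarrow> real" where
  "mixed_affine_surface_area_neg_n K =
     (SUP u\<in>sphere 0 1. \<Prod>i=1..CARD('n).
        curvature_function (K i) u powr (1 / (2 * real CARD('n))) *
        support_function (K i) u powr ((real CARD('n) + 1) / (2 * real CARD('n))))"

definition affine_surface_area_neg_n :: "(real^'n) set \<Rightarrow> real" where
  "affine_surface_area_neg_n K = mixed_affine_surface_area_neg_n (\<lambda>_. K)"

definition dilates :: "(real^'n) set \<Rightarrow> (real^'n) set \<Rightarrow> bool" where
  "dilates A B \<longleftrightarrow> (\<exists>c>0. A = (\<lambda>x. c *\<^sub>R x) ` B)"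

end

theory Submission
  imports Defs
begin

text \<open>
  Everything reduces to the function \<open>g\<^sub>K = f\<^sub>K\<^bsup>1/2n\<^esup> h\<^sub>K\<^bsup>(n+1)/2n\<^esup>\<close> on the sphere. Its transformation law
  \<open>g\<^bsub>TK\<^esub>(u) = |det T|\<^bsup>1/n\<^esup> g\<^sub>K(T\<^sup>\<top>u / |T\<^sup>\<top>u|)\<close> gives (i) and the behaviour under dilation, (ii) is the
  factorization of the product of the \<open>g\<close>'s at a maximum point, and (iii) and (iv) follow because the
  integrand of \<open>as\<^sub>p\<close> is that of \<open>as\<^sub>s\<close> times a power of the product of the \<open>g\<close>'s.

  The geometric input is that \<open>h\<^sub>K\<close> and \<open>f\<^sub>K\<close> are positive and continuous on the sphere, so that the
  supremum is attained and the integrals are finite. The Gauss map has closed graph, hence is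
  continuous; it is locally the normalized gradient of a defining function; positive curvature makes
  it injective, so it is a homeomorphism from the boundary to the sphere.
\<close>

section \<open>Centroids, tangent vectors and rank one perturbations\<close>

text \<open>The boundary is given only by local equations, and curvature is defined through a
  derivative within the frontier, which is determined only in directions that the frontier
  approaches. No chart of the boundary is constructed. Instead, tangent vectors are limits of secant
  directions, and two facts replace charts: every vector orthogonal to the normal is tangent, by the
  intermediate value theorem for a defining function, and derivatives within the frontier agree on
  tangent vectors. A second economy concerns linear images: the image of a body is never shown to be
  \<open>C2_plus\<close>. Its normals, boundary points and curvature are computed from those of the
  original body, because supporting hyperplanes transform by the transpose. What ties (i) to (iii)
  and (iv) is that the 2n-th power of g is f h^(n+1): this combination transforms only by the
  determinant, and the integrands for two values of p differ exactly by a power of it.\<close>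

lemma convex_body_nonempty: "convex_body K \<Longrightarrow> K \<noteq> {}"
  unfolding convex_body_def using interior_subset by blast

text \<open>Otherwise a hyperplane through the origin has all of \<open>K\<close> on its side
  \<open>0 \<le> a \<bullet> x\<close>. The integral of \<open>a \<bullet> x\<close> over
  \<open>K\<close> vanishes, so \<open>a \<bullet> x = 0\<close> almost everywhere on
  \<open>K\<close>, whereas it is positive on the interior, which is open and nonempty, hence not a
  null set.\<close>

lemma interior_centroid_zero:
  fixes K :: "(real^'n) set"
  assumes K: "convex_body K" and c: "centroid K = 0"
  shows "0 \<in> interior K"
proof (rule ccontr)
  assume n0: "0 \<notin> interior K"
  have cv: "convex K" and cp: "compact K" and ne: "interior K \<noteq> {}"
    using K by (auto simp: convex_body_def)
  obtain a where a: "a \<noteq> 0" "\<And>x. x \<in> interior K \<Longrightarrow> 0 \<le> a \<bullet> x"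
    using separating_hyperplane_set_0[OF convex_interior[OF cv] n0] by blast
  have nonneg: "0 \<le> a \<bullet> x" if "x \<in> K" for x
  proof -
    have "closure (interior K) \<subseteq> {x. 0 \<le> a \<bullet> x}"
      by (rule closure_minimal) (use a closed_halfspace_ge[of 0 a] in auto)
    moreover have "x \<in> closure (interior K)"
      using convex_closure_interior[OF cv ne] that closure_subset by auto
    ultimately show ?thesis by auto
  qed
  have pos: "0 < a \<bullet> x" if x: "x \<in> interior K" for x
  proof -
    obtain e where e: "e > 0" "cball x e \<subseteq> interior K"
      using open_contains_cball[of "interior K"] x by auto
    have "x - (e / norm a) *\<^sub>R a \<in> cball x e"
      using a e by (simp add: dist_norm)
    hence "0 \<le> a \<bullet> (x - (e / norm a) *\<^sub>R a)" using e a by blast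
    hence "a \<bullet> x \<ge> e / norm a * (a \<bullet> a)" by (simp add: inner_diff_right)
    moreover have "e / norm a * (a \<bullet> a) > 0" using e a by simp
    ultimately show ?thesis by linarith
  qed
  have notnull: "interior K \<notin> null_sets lborel"
    using open_not_negligible[OF open_interior ne]
    unfolding negligible_iff_null_sets using null_sets_completionI by blast
  \<comment> \<open>\<open>centroid\<close> divides by the volume and \<open>inverse 0 = 0\<close>,
    so the volume must be nonzero and finite before the integral itself is known to vanish.\<close>
  have "emeasure lborel K \<noteq> 0"
  proof
    assume "emeasure lborel K = 0"
    hence "K \<in> null_sets lborel" 
      using cp by (auto intro!: null_setsI borel_compact)
    hence "interior K \<in> null_sets lborel"
      by (rule null_sets_subset) (auto simp: interior_subset)
    thus False using notnull by simp
  qed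
  moreover have "emeasure lborel K \<noteq> top"
    using emeasure_bounded_finite[OF compact_imp_bounded[OF cp]] by simp
  ultimately have "measure lborel K \<noteq> 0"
    using emeasure_eq_ennreal_measure[of lborel K] by fastforce
  hence int0: "(LINT x:K|lborel. x) = 0" using c by (simp add: centroid_def)
  have int: "integrable lborel (\<lambda>x. indicator K x *\<^sub>R x)"
    by (rule borel_integrable_compact[OF cp]) (intro continuous_intros)
  have "(LINT x|lborel. (indicator K x *\<^sub>R x) \<bullet> a) = 0"
    using int0 by (subst integral_inner_left[OF int]) (simp add: set_lebesgue_integral_def)
  moreover have "integrable lborel (\<lambda>x. (indicator K x *\<^sub>R x) \<bullet> a)"
    by (rule integrable_inner_left) (rule int)
  moreover have "AE x in lborel. 0 \<le> (indicator K x *\<^sub>R x) \<bullet> a"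
    by (rule AE_I2) (use nonneg in \<open>auto simp: indicator_def inner_commute\<close>)
  ultimately have "AE x in lborel. (indicator K x *\<^sub>R x) \<bullet> a = 0"
    by (simp add: integral_nonneg_eq_0_iff_AE)
  hence "AE x in lborel. x \<notin> interior K"
    by (rule AE_mp) (rule AE_I2, use pos interior_subset[of K] in
      \<open>force simp: indicator_def inner_commute\<close>)
  hence "interior K \<in> null_sets lborel"
    by (subst (asm) AE_iff_null_sets[symmetric]) auto
  thus False using notnull by simp
qed

text \<open>The contingent (Bouligand) cone of \<open>S\<close> at \<open>x\<close>. A single
  \<open>e\<close> bounds both the step \<open>t\<close> and the relative error, which avoids
  sequences.\<close>

definition tangent_vector :: "'a::real_normed_vector set \<Rightarrow> 'a \<Rightarrow> 'a \<Rightarrow> bool" where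
  "tangent_vector S x v \<longleftrightarrow>
     (\<forall>e>0. \<exists>t y. 0 < t \<and> t < e \<and> y \<in> S \<and> norm (y - x - t *\<^sub>R v) \<le> e * t)"

text \<open>Along the approximating points \<open>f\<close> does not change, so
  \<open>D (y - x)\<close> is o(t). It also differs from \<open>t *\<^sub>R D v\<close> by o(t),
  because \<open>D\<close> is bounded. Dividing by \<open>t\<close> gives the claim.\<close>

lemma has_derivative_tangent_zero:
  fixes f :: "'a::real_normed_vector \<Rightarrow> 'b::real_normed_vector"
  assumes D: "(f has_derivative D) (at x within S)" and x: "x \<in> S"
    and v: "tangent_vector S x v" and c: "\<And>y. y \<in> S \<Longrightarrow> f y = f x"
  shows "D v = 0"
proof -
  have bl: "bounded_linear D" using D by (rule has_derivative_bounded_linear)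
  obtain B where B: "B > 0" "\<And>w. norm (D w) \<le> norm w * B"
    using bounded_linear.pos_bounded[OF bl] by blast
  have "norm (D v) \<le> 0 + e" if "e > 0" for e
  proof -
    \<comment> \<open>\<open>k\<close> adds up the coefficients of the two errors:
      \<open>norm v + 1\<close> from differentiability and \<open>B\<close> from replacing
      \<open>y - x\<close> by \<open>t *\<^sub>R v\<close>.\<close>
    define k where "k = norm v + 1 + B"
    have k: "k > 0" using B(1) norm_ge_zero[of v] unfolding k_def by linarith
    define e1 where "e1 = min 1 (e / k)"
    have e1: "e1 > 0" "e1 \<le> 1" "e1 * k \<le> e" 
      using that k by (auto simp: e1_def min_def field_simps)
    obtain d where d: "d > 0" "\<And>y. y \<in> S \<Longrightarrow> norm (y - x) < d \<Longrightarrow> 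
        norm (f y - f x - D (y - x)) \<le> e1 * norm (y - x)"
      using D e1(1) unfolding has_derivative_within_alt by blast
    define e2 where "e2 = min e1 (d / k)"
    have e2: "e2 > 0" "e2 \<le> e1" "e2 * k \<le> d"
      using d k e1 by (auto simp: e2_def min_def field_simps)
    obtain t y where ty: "0 < t" "t < e2" "y \<in> S" "norm (y - x - t *\<^sub>R v) \<le> e2 * t"
      using v e2(1) unfolding tangent_vector_def by blast
    have "norm (y - x) \<le> norm (y - x - t *\<^sub>R v) + norm (t *\<^sub>R v)"
      by (metis diff_add_cancel norm_triangle_ineq)
    also have "\<dots> \<le> e2 * t + t * norm v" using ty by simp
    also have "\<dots> \<le> t * (norm v + 1)" using e1 e2 ty(1) by (simp add: algebra_simps)
    finally have n1: "norm (y - x) \<le> t * (norm v + 1)" .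
    also have "\<dots> < e2 * (norm v + 1)"
      using ty by (intro mult_strict_right_mono) (auto intro: add_nonneg_pos)
    also have "\<dots> \<le> e2 * k" using B e2 by (simp add: k_def)
    finally have "norm (y - x) < d" using e2 by linarith
    hence "norm (D (y - x)) \<le> e1 * norm (y - x)"
      using d(2)[OF ty(3)] c[OF ty(3)] by simp
    also have "\<dots> \<le> e1 * (t * (norm v + 1))" using n1 e1 by simp
    finally have a1: "norm (D (y - x)) \<le> e1 * (t * (norm v + 1))" .
    have "norm (D (y - x - t *\<^sub>R v)) \<le> e2 * t * B"
      using B(2)[of "y - x - t *\<^sub>R v"] ty(4) B(1) by (meson mult_right_mono less_imp_le order_trans)
    also have "\<dots> \<le> e1 * t * B" using e2 ty(1) B(1) by simp
    finally have a2: "norm (D (y - x - t *\<^sub>R v)) \<le> e1 * t * B" .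
    have "t *\<^sub>R D v = D (y - x) - D (y - x - t *\<^sub>R v)"
      using bl by (simp add: linear_diff linear_scale bounded_linear.linear)
    hence "t * norm (D v) = norm (D (y - x) - D (y - x - t *\<^sub>R v))"
      using ty(1) by (metis abs_of_pos norm_scaleR)
    also have "\<dots> \<le> e1 * (t * (norm v + 1)) + e1 * t * B"
      using a1 a2 norm_triangle_ineq4[of "D (y - x)" "D (y - x - t *\<^sub>R v)"] by linarith
    also have "\<dots> = t * (e1 * k)" by (simp add: k_def algebra_simps)
    finally have "norm (D v) \<le> e1 * k" using ty(1) by simp
    thus ?thesis using e1 by linarith
  qed
  hence "norm (D v) \<le> 0" by (rule field_le_epsilon)
  thus ?thesis by simp
qed

lemma has_derivative_tangent_unique:
  assumes "(f has_derivative D) (at x within S)" "(f has_derivative D') (at x within S)"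
    and "x \<in> S" "tangent_vector S x v"
  shows "D v = D' v"
  using has_derivative_tangent_zero[OF has_derivative_diff[OF assms(1,2)] assms(3,4)] by simp

lemma tangent_vector_linear_image:
  assumes T: "bounded_linear T" and v: "tangent_vector S x v"
  shows "tangent_vector (T ` S) (T x) (T v)"
  unfolding tangent_vector_def
proof (intro allI impI)
  fix e :: real assume e: "e > 0"
  obtain B where B: "B > 0" "\<And>w. norm (T w) \<le> norm w * B"
    using bounded_linear.pos_bounded[OF T] by blast
  define d where "d = min e (e / B)"
  have d: "d > 0" "d \<le> e" "d * B \<le> e" using e B by (auto simp: d_def min_def field_simps)
  obtain t y where ty: "0 < t" "t < d" "y \<in> S" "norm (y - x - t *\<^sub>R v) \<le> d * t"
    using v d(1) unfolding tangent_vector_def by blast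
  have "T y - T x - t *\<^sub>R T v = T (y - x - t *\<^sub>R v)"
    using T by (simp add: linear_diff linear_scale bounded_linear.linear)
  hence "norm (T y - T x - t *\<^sub>R T v) \<le> norm (y - x - t *\<^sub>R v) * B" using B by simp
  also have "\<dots> \<le> d * t * B" using ty B by simp
  also have "\<dots> = (d * B) * t" by simp
  also have "\<dots> \<le> e * t" using d(3) ty by simp
  finally show "\<exists>t y. 0 < t \<and> t < e \<and> y \<in> T ` S \<and> norm (y - T x - t *\<^sub>R T v) \<le> e * t"
    using ty d by (intro exI[of _ t] exI[of _ "T y"]) auto
qed

lemma tangent_vector_segment:
  assumes "\<And>t. 0 < t \<Longrightarrow> t \<le> 1 \<Longrightarrow> x + t *\<^sub>R v \<in> S"
  shows "tangent_vector S x v"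
  unfolding tangent_vector_def
proof (intro allI impI)
  fix e :: real assume e: "e > 0"
  show "\<exists>t y. 0 < t \<and> t < e \<and> y \<in> S \<and> norm (y - x - t *\<^sub>R v) \<le> e * t"
    by (rule exI[of _ "min 1 (e/2)"], rule exI[of _ "x + min 1 (e/2) *\<^sub>R v"])
      (use e assms in auto)
qed

text \<open>The matrix determinant lemma. In orthogonal coordinates that make \<open>b\<close> a
  multiple of a basis vector, the map is the identity with one column replaced, and Cramer's rule
  evaluates that determinant.\<close>

lemma det_plus_rank_one:
  fixes a b :: "real^'n"
  shows "det (matrix (\<lambda>x. x + (b \<bullet> x) *\<^sub>R a)) = 1 + a \<bullet> b"
proof -
  have mid: "matrix (id :: real^'n \<Rightarrow> real^'n) = mat 1"
    by (rule matrix_id_mat_1)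
  show ?thesis
  proof (cases "b = 0")
    case True
    thus ?thesis using mid by (simp add: id_def det_I)
  next
    case False
    define k :: 'n where "k = (SOME k. True)"
    define c where "c = norm b"
    have c: "c > 0" using False by (simp add: c_def)
    have nb: "norm (b /\<^sub>R c) = 1" using False by (simp add: c_def)
    have nk: "norm (axis k 1 :: real^'n) = 1" by simp
    obtain f :: "real^'n \<Rightarrow> real^'n" where f: "orthogonal_transformation f" and fk: "f (axis k 1) = b /\<^sub>R c"
      by (rule orthogonal_transformation_exists_1[OF nk nb])
    have fb: "b = c *\<^sub>R f (axis k 1)" using fk c by simp
    have linf: "linear f" and fi: "\<And>x y. f x \<bullet> f y = x \<bullet> y"
      using f by (auto simp: orthogonal_transformation_def)
    obtain g where g: "linear g" "f \<circ> g = id" "g \<circ> f = id"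
      using linear_injective_isomorphism[OF linf orthogonal_transformation_inj[OF f]]
      by (auto simp: fun_eq_iff)
    have fg: "f (g x) = x" for x using g(2) by (metis comp_apply id_apply)
    define a' where "a' = g a"
    define h where "h = (\<lambda>x::real^'n. x + (c * (x $ k)) *\<^sub>R a')"
    have linh: "linear h"
      unfolding h_def by (rule linearI) (auto simp: algebra_simps)
    have eq: "(\<lambda>x. x + (b \<bullet> x) *\<^sub>R a) = f \<circ> h \<circ> g"
    proof
      fix x
      have "b \<bullet> x = c * (g x $ k)"
        using fi[of "axis k 1" "g x"] unfolding fg by (subst fb) (simp add: inner_axis_axis inner_axis')
      thus "x + (b \<bullet> x) *\<^sub>R a = (f \<circ> h \<circ> g) x"
        using linf by (simp add: h_def linear_add linear_scale a'_def fg)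
    qed
    have "matrix h = (\<chi> i j. if j = k then (mat 1 *v (axis k 1 + c *\<^sub>R a')) $ i else mat 1 $ i $ j)"
      unfolding matrix_vector_mul_lid by (auto simp: matrix_def h_def vec_eq_iff mat_def axis_def)
    hence "det (matrix h) = (axis k 1 + c *\<^sub>R a') $ k"
      by (simp only: cramer_lemma) simp
    also have "\<dots> = 1 + a \<bullet> b"
    proof -
      have "a \<bullet> b = f a' \<bullet> (c *\<^sub>R f (axis k 1))" by (subst fb) (simp add: a'_def fg)
      thus ?thesis by (simp add: fi inner_axis)
    qed
    finally have dh: "det (matrix h) = 1 + a \<bullet> b" .
    have "matrix f ** matrix g = mat 1"
      using matrix_compose[OF g(1) linf] g(2) mid by simp
    hence "det (matrix f) * det (matrix g) = 1" by (metis det_I det_mul)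
    thus ?thesis
      unfolding eq using dh linf linh g
      by (simp add: matrix_compose linear_compose det_mul)
  qed
qed

section \<open>The Gauss map\<close>

lemma convex_body_frontier_subset: "convex_body K \<Longrightarrow> frontier K \<subseteq> K"
  by (simp add: convex_body_def compact_imp_closed frontier_subset_closed)

lemma outer_unit_normal_frontier:
  assumes x: "x \<in> K" and u: "outer_unit_normal K x u"
  shows "x \<in> frontier K"
proof -
  have "x \<notin> interior K"
  proof
    assume "x \<in> interior K"
    then obtain e where e: "e > 0" "cball x e \<subseteq> K" by (auto simp: mem_interior_cball)
    have "x + e *\<^sub>R u \<in> cball x e" using e u by (simp add: dist_norm outer_unit_normal_def)
    hence "(x + e *\<^sub>R u) \<bullet> u \<le> x \<bullet> u" using e u by (auto simp: outer_unit_normal_def)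
    moreover have "u \<bullet> u = 1" using u by (simp add: outer_unit_normal_def norm_eq_1)
    ultimately show False using e by (simp add: inner_add_left)
  qed
  thus ?thesis using x closure_subset by (auto simp: frontier_def)
qed

lemma outer_unit_normal_exists:
  assumes K: "convex_body K" and x: "x \<in> frontier K"
  obtains u where "outer_unit_normal K x u"
proof -
  have cv: "convex K" and ne: "interior K \<noteq> {}" using K by (auto simp: convex_body_def)
  have "x \<in> closure K" "x \<notin> rel_interior K"
    using x ne by (auto simp: frontier_def interior_rel_interior_gen rel_interior_nonempty_interior)
  then obtain a where a: "a \<noteq> 0" "\<And>y. y \<in> closure K \<Longrightarrow> a \<bullet> x \<le> a \<bullet> y"
    using supporting_hyperplane_relative_frontier[OF cv] by metis
  have "outer_unit_normal K x (- (a /\<^sub>R norm a))"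
    using a closure_subset[of K]
    by (auto simp: outer_unit_normal_def inner_commute divide_simps intro!: mult_left_mono)
  thus ?thesis by (rule that)
qed

lemma outer_unit_normal_exists_point:
  fixes K :: "(real^'n) set"
  assumes K: "convex_body K" and u: "norm u = 1"
  obtains x where "x \<in> frontier K" "outer_unit_normal K x u"
proof -
  have "compact K" "K \<noteq> {}" using K convex_body_nonempty by (auto simp: convex_body_def)
  then obtain x where x: "x \<in> K" "\<And>y. y \<in> K \<Longrightarrow> y \<bullet> u \<le> x \<bullet> u"
    using continuous_attains_sup[of K "\<lambda>y. y \<bullet> u"] continuous_on_inner[OF continuous_on_id continuous_on_const]
    by (metis (no_types))
  hence "outer_unit_normal K x u" using u by (simp add: outer_unit_normal_def)
  thus ?thesis using that outer_unit_normal_frontier x by blast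
qed

lemma support_function_eq_outer_unit_normal:
  assumes "outer_unit_normal K x u" "x \<in> K"
  shows "support_function K u = x \<bullet> u"
  unfolding support_function_def
  by (rule cSup_eq_maximum) (use assms in \<open>auto simp: outer_unit_normal_def\<close>)

lemma gauss_map_eqI:
  assumes "outer_unit_normal K x u" "\<And>v. outer_unit_normal K x v \<Longrightarrow> v = u"
  shows "gauss_map K x = u"
  unfolding gauss_map_def using assms by (rule the_equality)

text \<open>The directional derivative is affine along the segment, so its smaller endpoint value
  bounds it below and one \<open>d\<close> serves all directions at once. This uniformity keeps a
  whole segment of points off the level set.\<close>

lemma derivative_positive_on_segment:
  fixes F :: "'a::euclidean_space \<Rightarrow> real"
  assumes D: "(F has_derivative (\<lambda>v. g \<bullet> v)) (at x)" and F: "F x = 0"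
    and U: "open U" "x \<in> U" and w0: "g \<bullet> w0 > 0" and w1: "g \<bullet> w1 > 0"
  obtains d where "d > 0"
    "\<And>t w. 0 < t \<Longrightarrow> t < d \<Longrightarrow> w \<in> closed_segment w0 w1 \<Longrightarrow> x + t *\<^sub>R w \<in> U \<and> F (x + t *\<^sub>R w) > 0"
proof -
  \<comment> \<open>With tolerance \<open>m / (2 * M)\<close> the remainder is at most
    \<open>t * m / 2\<close>, half of the lower bound \<open>t * m\<close> for the linear
    term.\<close>
  define m where "m = min (g \<bullet> w0) (g \<bullet> w1)"
  define M where "M = norm w0 + norm w1 + 1"
  have m: "m > 0" and M: "M > 0" using w0 w1 by (auto simp: m_def M_def add_nonneg_pos)
  obtain r where r: "r > 0" "\<And>y. norm (y - x) < r \<Longrightarrow>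
      norm (F y - F x - g \<bullet> (y - x)) \<le> (m / (2 * M)) * norm (y - x)"
    using D m M unfolding has_derivative_at_alt by (metis divide_pos_pos mult_pos_pos zero_less_numeral)
  obtain q where q: "q > 0" "ball x q \<subseteq> U" using U open_contains_ball by blast
  define d where "d = min r q / M"
  show ?thesis
  proof (rule that[of d])
    show "d > 0" using r q M by (simp add: d_def)
  next
    fix t w assume t: "0 < t" "t < d" and w: "w \<in> closed_segment w0 w1"
    obtain l where l: "0 \<le> l" "l \<le> 1" "w = (1 - l) *\<^sub>R w0 + l *\<^sub>R w1"
      using w by (auto simp: in_segment)
    have "norm w \<le> (1 - l) * norm w0 + l * norm w1"
      using l by (metis (no_types, lifting) abs_of_nonneg diff_ge_0_iff_ge norm_scaleR norm_triangle_ineq)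
    also have "\<dots> \<le> 1 * norm w0 + 1 * norm w1" using l by (intro add_mono mult_right_mono) auto
    finally have nw: "norm w \<le> M" by (simp add: M_def)
    have "g \<bullet> w = (1 - l) * (g \<bullet> w0) + l * (g \<bullet> w1)" using l by (simp add: inner_add_right)
    also have "\<dots> \<ge> (1 - l) * m + l * m"
      using l by (intro add_mono mult_left_mono) (auto simp: m_def)
    finally have gw: "g \<bullet> w \<ge> m" by (simp add: algebra_simps)
    have "norm (t *\<^sub>R w) \<le> t * M" using t nw by simp
    also have "\<dots> < d * M" using t M by simp
    finally have n: "norm (t *\<^sub>R w) < min r q" using M by (simp add: d_def)
    hence U': "x + t *\<^sub>R w \<in> U" using q by (auto simp: dist_norm)
    have "\<bar>F (x + t *\<^sub>R w) - t * (g \<bullet> w)\<bar> \<le> (m / (2 * M)) * norm (t *\<^sub>R w)"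
      using r(2)[of "x + t *\<^sub>R w"] n F by simp
    also have "\<dots> \<le> (m / (2 * M)) * (t * M)" using t nw m M by (intro mult_left_mono) auto
    also have "\<dots> = t * m / 2" using M by simp
    finally have "F (x + t *\<^sub>R w) \<ge> t * (g \<bullet> w) - t * m / 2" by linarith
    moreover have "t * (g \<bullet> w) \<ge> t * m" using gw t by simp
    moreover have "t * m > 0" using t m by simp
    ultimately show "x + t *\<^sub>R w \<in> U \<and> F (x + t *\<^sub>R w) > 0" using U' by linarith
  qed
qed

text \<open>A side of the level set contains points of the interior of \<open>K\<close>, and
  connectedness propagates this to every direction on that side; so the normal is orthogonal to the
  level set without appeal to the implicit function theorem.\<close>

lemma outer_unit_normal_level_set_aux:
  fixes K :: "(real^'n) set"
  assumes K: "convex_body K" and x: "x \<in> frontier K" and U: "open U" "x \<in> U"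
    and D: "(F has_derivative (\<lambda>v. g \<bullet> v)) (at x)" and g: "g \<noteq> 0"
    and fr: "frontier K \<inter> U = {y\<in>U. F y = 0}"
    and z: "z \<in> interior K" "g \<bullet> (z - x) > 0"
    and u: "outer_unit_normal K x u"
  shows "u = - (g /\<^sub>R norm g)"
proof -
  have cv: "convex K" using K by (simp add: convex_body_def)
  have Fx: "F x = 0" using fr x U by blast
  have half: "u \<bullet> w \<le> 0" if w: "g \<bullet> w > 0" for w
  proof -
    obtain d where d: "d > 0" "\<And>t v. 0 < t \<Longrightarrow> t < d \<Longrightarrow> v \<in> closed_segment (z - x) w \<Longrightarrow>
        x + t *\<^sub>R v \<in> U \<and> F (x + t *\<^sub>R v) > 0"
      using derivative_positive_on_segment[OF D Fx U z(2) w] by metis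
    define t where "t = min (d/2) (1/2)"
    have t: "0 < t" "t < d" "t < 1" using d by (auto simp: t_def)
    define S where "S = (\<lambda>v. x + t *\<^sub>R v) ` closed_segment (z - x) w"
    have S0: "S \<inter> frontier K = {}"
    proof -
      have "y \<in> U \<and> F y > 0" if "y \<in> S" for y
        using that d(2)[OF t(1,2)] by (auto simp: S_def)
      thus ?thesis using fr by force
    qed
    have "connected S" unfolding S_def
      by (intro connected_continuous_image continuous_intros connected_segment)
    moreover have "x - t *\<^sub>R (x - z) \<in> interior K"
      using x t by (intro mem_interior_closure_convex_shrink[OF cv z(1)]) (auto simp: frontier_def)
    hence "x + t *\<^sub>R (z - x) \<in> K" using interior_subset by (auto simp: algebra_simps)
    hence "S \<inter> K \<noteq> {}" unfolding S_def by auto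
    ultimately have "S - K = {}" using connected_Int_frontier[of S K] S0 by blast
    hence "x + t *\<^sub>R w \<in> K" unfolding S_def by auto
    hence "(x + t *\<^sub>R w) \<bullet> u \<le> x \<bullet> u" using u by (simp add: outer_unit_normal_def)
    hence "t * (u \<bullet> w) \<le> 0" by (simp add: inner_add_left inner_add_right inner_commute)
    thus ?thesis using t by (simp add: mult_le_0_iff)
  qed
  define a where "a = g /\<^sub>R norm g"
  have na: "norm a = 1" and ga: "g = norm g *\<^sub>R a" using g by (auto simp: a_def)
  have nu: "norm u = 1" using u by (simp add: outer_unit_normal_def)
  \<comment> \<open>The vectors \<open>u + t *\<^sub>R a\<close> with
    \<open>t > - (u \<bullet> a)\<close> lie in the open half-space to which \<open>half\<close>
    applies. Letting \<open>t\<close> tend to \<open>- (u \<bullet> a)\<close> gives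
    \<open>(u \<bullet> a)^2 \<ge> 1\<close>, the equality case of Cauchy-Schwarz.\<close>
  have "1 + t * (u \<bullet> a) \<le> 0" if t: "t > - (u \<bullet> a)" for t
  proof -
    have "g \<bullet> (u + t *\<^sub>R a) = norm g * (u \<bullet> a + t)"
      by (subst ga) (use na in \<open>simp add: inner_add_right norm_eq_1 inner_commute distrib_left\<close>)
    also have "\<dots> > 0" using t g by simp
    finally have "u \<bullet> (u + t *\<^sub>R a) \<le> 0" by (rule half)
    thus ?thesis using nu by (simp add: inner_add_right norm_eq_1)
  qed
  note * = this
  have "g \<bullet> a = norm g"
    using g by (simp add: a_def power2_norm_eq_inner[symmetric] power2_eq_square)
  hence ua0: "u \<bullet> a \<le> 0" using half[of a] g by simp
  have "1 - (u \<bullet> a)^2 \<le> 0 + e" if e: "e > 0" for e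
  proof -
    define s where "s = e / (1 - u \<bullet> a)"
    have s: "s > 0" using e ua0 by (simp add: s_def)
    have "1 + (- (u \<bullet> a) + s) * (u \<bullet> a) \<le> 0" by (rule *) (use s in simp)
    hence "1 - (u \<bullet> a)^2 \<le> s * - (u \<bullet> a)" by (simp add: power2_eq_square algebra_simps)
    also have "\<dots> \<le> s * (1 - u \<bullet> a)" using s by (intro mult_left_mono) auto
    also have "\<dots> = e" using ua0 by (simp add: s_def)
    finally show ?thesis by simp
  qed
  hence "1 - (u \<bullet> a)^2 \<le> 0" by (rule field_le_epsilon)
  hence "(u \<bullet> a)^2 \<ge> 1\<^sup>2" by simp
  hence "- (u \<bullet> a) \<ge> 1" using ua0 by (metis abs_le_square_iff abs_of_nonpos abs_one)
  hence "u \<bullet> (- a) = norm u * norm (- a)"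
    using norm_cauchy_schwarz[of u "- a"] na nu by simp
  hence "norm u *\<^sub>R (- a) = norm (- a) *\<^sub>R u" by (simp only: norm_cauchy_schwarz_eq)
  thus ?thesis using na nu unfolding a_def[symmetric] by simp
qed

text \<open>The sign is decided by the side of the tangent hyperplane on which an interior point
  lies. It is chosen before \<open>u\<close>, so all outer unit normals at \<open>x\<close>
  coincide.\<close>

lemma outer_unit_normal_level_set:
  fixes K :: "(real^'n) set"
  assumes K: "convex_body K" and x: "x \<in> frontier K" and U: "open U" "x \<in> U"
    and D: "(F has_derivative (\<lambda>v. g \<bullet> v)) (at x)" and g: "g \<noteq> 0"
    and fr: "frontier K \<inter> U = {y\<in>U. F y = 0}"
  shows "\<exists>c\<in>{-1,1}. \<forall>u. outer_unit_normal K x u \<longrightarrow> u = c *\<^sub>R (g /\<^sub>R norm g)"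
proof -
  obtain z0 where z0: "z0 \<in> interior K" using K by (auto simp: convex_body_def)
  \<comment> \<open>The interior is open, so an interior point on the tangent hyperplane can be
    moved off it along \<open>g\<close>.\<close>
  obtain z where z: "z \<in> interior K" "g \<bullet> (z - x) \<noteq> 0"
  proof (cases "g \<bullet> (z0 - x) = 0")
    case True
    obtain e where e: "e > 0" "cball z0 e \<subseteq> interior K"
      using open_contains_cball[of "interior K"] z0 by auto
    have "z0 + (e / norm g) *\<^sub>R g \<in> cball z0 e" using e g by (simp add: dist_norm)
    moreover have "g \<bullet> (z0 + (e / norm g) *\<^sub>R g - x) = e / norm g * (g \<bullet> g)"
      using True by (simp add: inner_diff_right inner_add_right)
    ultimately show ?thesis using that e g by auto
  qed (use z0 in auto)
  show ?thesis
  proof (cases "g \<bullet> (z - x) > 0")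
    case True
    show ?thesis
      using outer_unit_normal_level_set_aux[OF K x U D g fr z(1) True]
      by (intro bexI[of _ "-1"]) (auto simp del: scaleR_scaleR)
  next
    case False
    \<comment> \<open>If the interior point lies on the other side, \<open>- F\<close> defines the
      same level set with the opposite gradient.\<close>
    have "((\<lambda>y. - F y) has_derivative (\<lambda>v. (- g) \<bullet> v)) (at x)"
      using has_derivative_minus[OF D] by simp
    from outer_unit_normal_level_set_aux[OF K x U this _ _ z(1)] show ?thesis
      using False z g fr by (intro bexI[of _ "1"]) auto
  qed
qed

section \<open>Uniqueness and continuity of the normal\<close>

lemma C2_plus_local:
  assumes K: "C2_plus K" and x: "x \<in> frontier K"
  obtains U F G H where "open U" "x \<in> U"
    "\<forall>y\<in>U. (F has_derivative (\<lambda>v. G y \<bullet> v)) (at y)"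
    "\<forall>y\<in>U. (G has_derivative (\<lambda>v. H y *v v)) (at y)"
    "continuous_on U H" "\<forall>y\<in>U. G y \<noteq> 0" "frontier K \<inter> U = {y\<in>U. F y = 0}"
proof -
  have "C2_boundary K" using K by (simp add: C2_plus_def)
  from this[unfolded C2_boundary_def, THEN bspec, OF x]
  obtain U F G H where *: "open U \<and> x \<in> U \<and> C2_on U F G H \<and>
      (\<forall>y\<in>U. G y \<noteq> 0) \<and> frontier K \<inter> U = {y\<in>U. F y = 0}"
    by (elim exE) (rule that)
  show ?thesis by (rule that[of U F G H]) (use * in \<open>simp_all add: C2_on_def\<close>)
qed

lemma C2_plus_outer_unit_normal_unique:
  fixes K :: "(real^'n) set"
  assumes K: "C2_plus K" and x: "x \<in> frontier K"
    and u: "outer_unit_normal K x u" and v: "outer_unit_normal K x v"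
  shows "u = v"
proof -
  have cb: "convex_body K" using K by (simp add: C2_plus_def)
  obtain U F G H where "open U" "x \<in> U"
    "\<forall>y\<in>U. (F has_derivative (\<lambda>v. G y \<bullet> v)) (at y)"
    "\<forall>y\<in>U. (G has_derivative (\<lambda>v. H y *v v)) (at y)"
    "continuous_on U H" "\<forall>y\<in>U. G y \<noteq> 0" "frontier K \<inter> U = {y\<in>U. F y = 0}"
    by (rule C2_plus_local[OF K x])
  from outer_unit_normal_level_set[OF cb x this(1,2) bspec[OF this(3,2)] bspec[OF this(6,2)] this(7)]
  obtain c where c: "\<And>u. outer_unit_normal K x u \<Longrightarrow> u = c *\<^sub>R (G x /\<^sub>R norm (G x))" by blast
  show ?thesis using c[OF u] c[OF v] by (rule trans[OF _ sym])
qed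

lemma C2_plus_gauss_map:
  assumes K: "C2_plus K" and x: "x \<in> frontier K"
  shows "outer_unit_normal K x (gauss_map K x)"
proof -
  obtain u where u: "outer_unit_normal K x u"
    using outer_unit_normal_exists[OF _ x] K by (auto simp: C2_plus_def)
  thus ?thesis using gauss_map_eqI C2_plus_outer_unit_normal_unique[OF K x] by metis
qed

lemma C2_plus_gauss_map_eq:
  "C2_plus K \<Longrightarrow> x \<in> frontier K \<Longrightarrow> outer_unit_normal K x u \<Longrightarrow> gauss_map K x = u"
  using C2_plus_gauss_map C2_plus_outer_unit_normal_unique by blast

lemma norm_gauss_map: "C2_plus K \<Longrightarrow> x \<in> frontier K \<Longrightarrow> norm (gauss_map K x) = 1"
  using C2_plus_gauss_map unfolding outer_unit_normal_def by blast

lemma continuous_on_gauss_map: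
  fixes K :: "(real^'n) set"
  assumes K: "C2_plus K"
  shows "continuous_on (frontier K) (gauss_map K)"
proof -
  let ?S = "frontier K" and ?T = "sphere 0 1 :: (real^'n) set"
  have cb: "convex_body K" using K by (simp add: C2_plus_def)
  \<comment> \<open>Uniqueness of the normal identifies the graph with the set of supporting pairs,
    which is cut out by closed conditions. Compactness of the sphere then turns the closed graph
    into continuity.\<close>
  have g: "(\<lambda>x. (x, gauss_map K x)) ` ?S
      = (?S \<times> ?T) \<inter> {p. \<forall>y\<in>K. y \<bullet> snd p \<le> fst p \<bullet> snd p}" (is "?L = ?R")
  proof
    show "?L \<subseteq> ?R"
      using C2_plus_gauss_map[OF K] by (auto simp: outer_unit_normal_def)
    show "?R \<subseteq> ?L"
      using C2_plus_gauss_map_eq[OF K] by (force simp: outer_unit_normal_def)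
  qed
  have "closed {p::(real^'n)\<times>(real^'n). \<forall>y\<in>K. y \<bullet> snd p \<le> fst p \<bullet> snd p}"
    unfolding Ball_def by (intro closed_Collect_all closed_Collect_imp closed_Collect_le continuous_intros) simp
  hence "closedin (top_of_set (?S \<times> ?T)) ?L"
    unfolding g closedin_closed by blast
  moreover have "gauss_map K \<in> ?S \<rightarrow> ?T" using norm_gauss_map[OF K] by auto
  ultimately show ?thesis using continuous_closed_graph_eq[of ?T "gauss_map K" ?S] by auto
qed

section \<open>Gauss curvature\<close>

text \<open>At each boundary point separately the normal is the normalized gradient up to a sign.
  Continuity of the Gauss map makes the sign constant on a smaller neighbourhood, where the Gauss
  map is then the restriction of a differentiable map.\<close>

lemma C2_plus_gauss_map_local:
  fixes K :: "(real^'n) set"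
  assumes K: "C2_plus K" and x: "x \<in> frontier K"
  obtains V F G H c where "open V" "x \<in> V"
    "\<forall>y\<in>V. (F has_derivative (\<lambda>v. G y \<bullet> v)) (at y)"
    "\<forall>y\<in>V. (G has_derivative (\<lambda>v. H y *v v)) (at y)"
    "continuous_on V H" "\<forall>y\<in>V. G y \<noteq> 0" "frontier K \<inter> V = {y\<in>V. F y = 0}"
    "c \<in> {-1, 1::real}" "\<forall>y\<in>frontier K \<inter> V. gauss_map K y = c *\<^sub>R (G y /\<^sub>R norm (G y))"
proof -
  have cb: "convex_body K" using K by (simp add: C2_plus_def)
  obtain U F G H where U: "open U" "x \<in> U"
    and dF: "\<forall>y\<in>U. (F has_derivative (\<lambda>v. G y \<bullet> v)) (at y)"
    and dG: "\<forall>y\<in>U. (G has_derivative (\<lambda>v. H y *v v)) (at y)"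
    and cH: "continuous_on U H" and G0: "\<forall>y\<in>U. G y \<noteq> 0"
    and fr: "frontier K \<inter> U = {y\<in>U. F y = 0}"
    by (rule C2_plus_local[OF K x])
  have loc: "\<exists>c\<in>{-1,1}. gauss_map K y = c *\<^sub>R (G y /\<^sub>R norm (G y))" if "y \<in> frontier K \<inter> U" for y
  proof -
    have y: "y \<in> frontier K" "y \<in> U" using that by auto
    from outer_unit_normal_level_set[OF cb y(1) U(1) y(2) bspec[OF dF y(2)] bspec[OF G0 y(2)] fr]
    show ?thesis using C2_plus_gauss_map[OF K y(1)] by blast
  qed
  obtain c where c: "c \<in> {-1, 1::real}" "gauss_map K x = c *\<^sub>R (G x /\<^sub>R norm (G x))"
    using loc x U(2) by blast
  have cG: "continuous_on U G"
    using dG has_derivative_continuous continuous_at_imp_continuous_on by blast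
  \<comment> \<open>If \<open>d\<close> is the sign at \<open>y\<close>, then
    \<open>q y = c * d * norm (G y)\<close>, so positivity of the continuous function
    \<open>q\<close> detects \<open>d = c\<close>.\<close>
  define q where "q = (\<lambda>y. c * (gauss_map K y \<bullet> G y))"
  have q: "q y = c * d * norm (G y)" if "gauss_map K y = d *\<^sub>R (G y /\<^sub>R norm (G y))" for y d
    by (cases "G y = 0") (simp_all add: q_def that power2_norm_eq_inner[symmetric] power2_eq_square)
  have "continuous_on (frontier K \<inter> U) q" unfolding q_def
    by (intro continuous_intros continuous_on_subset[OF cG]
        continuous_on_subset[OF continuous_on_gauss_map[OF K]]) auto
  hence "openin (top_of_set (frontier K \<inter> U)) ((frontier K \<inter> U) \<inter> q -` {0<..})"
    using continuous_on_open_gen[of q "frontier K \<inter> U" UNIV] by simp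
  then obtain W where W: "open W" "(frontier K \<inter> U) \<inter> q -` {0<..} = (frontier K \<inter> U) \<inter> W"
    unfolding openin_open by blast
  have "q x > 0" using q[OF c(2)] c(1) G0 U(2) by auto
  hence xW: "x \<in> W" using W(2) x U(2) by blast
  show ?thesis
  proof (rule that[of "U \<inter> W" F G H c])
    show "\<forall>y\<in>frontier K \<inter> (U \<inter> W). gauss_map K y = c *\<^sub>R (G y /\<^sub>R norm (G y))"
    proof
      fix y assume y: "y \<in> frontier K \<inter> (U \<inter> W)"
      hence qy: "q y > 0" using W(2) by blast
      obtain d where d: "d \<in> {-1, 1::real}" "gauss_map K y = d *\<^sub>R (G y /\<^sub>R norm (G y))"
        using loc y by blast
      have "c * d * norm (G y) > 0" using qy q[OF d(2)] by simp
      hence "c * d > 0" by (simp add: zero_less_mult_iff)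
      hence "d = c" using c(1) d(1) by auto
      thus "gauss_map K y = c *\<^sub>R (G y /\<^sub>R norm (G y))" using d(2) by simp
    qed
    show "continuous_on (U \<inter> W) H" using cH by (rule continuous_on_subset) auto
    show "frontier K \<inter> (U \<inter> W) = {y \<in> U \<inter> W. F y = 0}" using fr by blast
  qed (use U W xW dF dG G0 c in auto)
qed

text \<open>With \<open>a\<close> the normalized gradient and \<open>t\<close> small,
  \<open>F\<close> is negative at \<open>x + t *\<^sub>R (v - e *\<^sub>R a)\<close> and positive at
  \<open>x + t *\<^sub>R (v + e *\<^sub>R a)\<close>. A zero in between is a boundary point within
  \<open>e * t\<close> of \<open>x + t *\<^sub>R v\<close>.\<close>

lemma tangent_vector_frontier:
  fixes K :: "(real^'n) set"
  assumes K: "C2_plus K" and x: "x \<in> frontier K" and v: "v \<bullet> gauss_map K x = 0"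
  shows "tangent_vector (frontier K) x v"
  unfolding tangent_vector_def
proof (intro allI impI)
  fix e :: real assume e: "e > 0"
  obtain V F G H c where V: "open V" "x \<in> V"
    and dF: "\<forall>y\<in>V. (F has_derivative (\<lambda>v. G y \<bullet> v)) (at y)"
    and "\<forall>y\<in>V. (G has_derivative (\<lambda>v. H y *v v)) (at y)"
    and "continuous_on V H" and G0: "\<forall>y\<in>V. G y \<noteq> 0"
    and fr: "frontier K \<inter> V = {y\<in>V. F y = 0}"
    and c: "c \<in> {-1, 1::real}" and \<nu>: "\<forall>y\<in>frontier K \<inter> V. gauss_map K y = c *\<^sub>R (G y /\<^sub>R norm (G y))"
    by (rule C2_plus_gauss_map_local[OF K x])
  define a where "a = G x /\<^sub>R norm (G x)"
  have G0: "G x \<noteq> 0" using G0 V by blast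
  have a: "norm a = 1" "G x \<bullet> a = norm (G x)"
    using G0 by (simp_all add: a_def power2_norm_eq_inner[symmetric] power2_eq_square)
  have "gauss_map K x = c *\<^sub>R a" using \<nu> x V by (simp add: a_def)
  hence "v \<bullet> a = 0" using v c by auto
  hence va: "G x \<bullet> v = 0" using G0 by (simp add: a_def inner_commute)
  have Fx: "F x = 0" using fr x V by blast
  have DF: "(F has_derivative (\<lambda>v. G x \<bullet> v)) (at x)" using dF V by blast
  have DF': "((\<lambda>y. - F y) has_derivative (\<lambda>v. (- G x) \<bullet> v)) (at x)"
    using has_derivative_minus[OF DF] by simp
  have p0: "G x \<bullet> (v + e *\<^sub>R a) > 0" using va a e G0 by (simp add: inner_add_right)
  have p1: "(- G x) \<bullet> (v - e *\<^sub>R a) > 0" using va a e G0 by (simp add: inner_diff_right)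
  \<comment> \<open>The segments are degenerate here, since only one direction is tested on each
    side.\<close>
  obtain d0 where d0: "d0 > 0" "\<And>t w. 0 < t \<Longrightarrow> t < d0 \<Longrightarrow>
      w \<in> closed_segment (v + e *\<^sub>R a) (v + e *\<^sub>R a) \<Longrightarrow> x + t *\<^sub>R w \<in> V \<and> F (x + t *\<^sub>R w) > 0"
    using derivative_positive_on_segment[OF DF Fx V p0 p0] by metis
  obtain d1 where d1: "d1 > 0" "\<And>t w. 0 < t \<Longrightarrow> t < d1 \<Longrightarrow>
      w \<in> closed_segment (v - e *\<^sub>R a) (v - e *\<^sub>R a) \<Longrightarrow> x + t *\<^sub>R w \<in> V \<and> - F (x + t *\<^sub>R w) > 0"
    using derivative_positive_on_segment[OF DF' _ V p1 p1] Fx by auto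
  obtain q where q: "q > 0" "ball x q \<subseteq> V" using V open_contains_ball by blast
  define M where "M = norm v + e"
  have M: "M > 0" using e by (simp add: M_def add_nonneg_pos)
  define t where "t = min (min d0 d1) (min e (q / M)) / 2"
  have t0: "0 < t" using d0 d1 e q M by (simp add: t_def)
  have t: "t < d0" "t < d1" "t < e" "t < q / M"
    using t0 unfolding t_def by linarith+
  have inV: "x + t *\<^sub>R (v + s *\<^sub>R a) \<in> V" if s: "- e \<le> s" "s \<le> e" for s
  proof -
    have "norm (v + s *\<^sub>R a) \<le> norm v + \<bar>s\<bar>" using a norm_triangle_ineq[of v "s *\<^sub>R a"] by simp
    also have "\<dots> \<le> M" using s by (simp add: M_def)
    finally have "norm (t *\<^sub>R (v + s *\<^sub>R a)) \<le> t * M" using t0 by simp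
    also have "\<dots> < q" using t(4) M by (simp add: field_simps)
    finally show ?thesis using q by (auto simp: dist_norm)
  qed
  have "continuous_on V F"
    using dF has_derivative_continuous continuous_at_imp_continuous_on by blast
  hence "continuous_on {-e..e} (\<lambda>s. F (x + t *\<^sub>R (v + s *\<^sub>R a)))"
    by (rule continuous_on_compose2) (use inV in \<open>auto intro!: continuous_intros\<close>)
  moreover have "F (x + t *\<^sub>R (v + (-e) *\<^sub>R a)) \<le> 0" using d1(2)[OF t0 t(2)] by simp
  moreover have "0 \<le> F (x + t *\<^sub>R (v + e *\<^sub>R a))" using d0(2)[OF t0 t(1)] by force
  ultimately obtain s where s: "- e \<le> s" "s \<le> e" "F (x + t *\<^sub>R (v + s *\<^sub>R a)) = 0"
    using IVT'[of "\<lambda>s. F (x + t *\<^sub>R (v + s *\<^sub>R a))" "-e" 0 e] e by auto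
  show "\<exists>t y. 0 < t \<and> t < e \<and> y \<in> frontier K \<and> norm (y - x - t *\<^sub>R v) \<le> e * t"
  proof (intro exI conjI)
    show "x + t *\<^sub>R (v + s *\<^sub>R a) \<in> frontier K" using s inV fr by blast
    have "x + t *\<^sub>R (v + s *\<^sub>R a) - x - t *\<^sub>R v = (t * s) *\<^sub>R a" by (simp add: algebra_simps)
    hence "norm (x + t *\<^sub>R (v + s *\<^sub>R a) - x - t *\<^sub>R v) = \<bar>s\<bar> * t"
      using a t0 by (simp add: abs_mult)
    also have "\<dots> \<le> e * t" using s t0 by (intro mult_right_mono) auto
    finally show "norm (x + t *\<^sub>R (v + s *\<^sub>R a) - x - t *\<^sub>R v) \<le> e * t" .
  qed (use t0 t in auto)
qed

section \<open>The differential of the Gauss map\<close>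

lemma has_derivative_normalize:
  fixes x :: "'a::real_inner"
  assumes "x \<noteq> 0"
  shows "((\<lambda>x. x /\<^sub>R norm x) has_derivative (\<lambda>v. v /\<^sub>R norm x - ((x \<bullet> v) / norm x ^ 3) *\<^sub>R x)) (at x)"
proof -
  have "((\<lambda>x. inverse (norm x) *\<^sub>R x) has_derivative
     (\<lambda>v. inverse (norm x) *\<^sub>R v + (- (inverse (norm x) * (v \<bullet> sgn x) * inverse (norm x))) *\<^sub>R x)) (at x)"
    using assms by (auto intro!: derivative_eq_intros has_derivative_norm)
  moreover have "inverse (norm x) *\<^sub>R v + (- (inverse (norm x) * (v \<bullet> sgn x) * inverse (norm x))) *\<^sub>R x
      = v /\<^sub>R norm x - ((x \<bullet> v) / norm x ^ 3) *\<^sub>R x" for v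
    using assms by (simp add: sgn_div_norm inner_commute power3_eq_cube divide_simps)
  ultimately show ?thesis by (simp only:)
qed

text \<open>The derivative of \<open>c g / |g|\<close>, where \<open>g\<close> and \<open>h\<close> are the gradient and the Hessian of a defining
  function and \<open>c\<close> is the sign that makes the normal point outwards.\<close>

definition normal_derivative :: "real \<Rightarrow> real^'n \<Rightarrow> real^'n^'n \<Rightarrow> real^'n \<Rightarrow> real^'n" where
  "normal_derivative c g h v = c *\<^sub>R ((h *v v) /\<^sub>R norm g - ((g \<bullet> (h *v v)) / norm g ^ 3) *\<^sub>R g)"

lemma gauss_map_has_derivative:
  fixes K :: "(real^'n) set"
  assumes V: "open V" "y \<in> V" and y: "y \<in> frontier K"
    and dG: "(G has_derivative (\<lambda>v. H *v v)) (at y)" and G0: "G y \<noteq> 0"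
    and \<nu>: "\<forall>y\<in>frontier K \<inter> V. gauss_map K y = c *\<^sub>R (G y /\<^sub>R norm (G y))"
  shows "(gauss_map K has_derivative normal_derivative c (G y) H) (at y within frontier K)"
proof -
  have "((\<lambda>z. c *\<^sub>R (G z /\<^sub>R norm (G z))) has_derivative normal_derivative c (G y) H) (at y)"
    unfolding normal_derivative_def
    by (intro has_derivative_scaleR_right has_derivative_compose[OF dG has_derivative_normalize[OF G0]])
  hence *: "((\<lambda>z. c *\<^sub>R (G z /\<^sub>R norm (G z))) has_derivative normal_derivative c (G y) H)
      (at y within frontier K)"
    by (rule has_derivative_at_withinI)
  obtain e where "e > 0" "ball y e \<subseteq> V" using V open_contains_ball by blast
  thus ?thesis
    by (intro has_derivative_transform_within[OF *, of e])
      (use y \<nu> in \<open>auto simp: subset_iff dist_commute\<close>)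
qed

lemma gauss_map_differentiable:
  fixes K :: "(real^'n) set"
  assumes K: "C2_plus K" and x: "x \<in> frontier K"
  obtains D where "(gauss_map K has_derivative D) (at x within frontier K)"
proof -
  obtain V F G H c where V: "open V" "x \<in> V"
    and dF: "\<forall>y\<in>V. (F has_derivative (\<lambda>v. G y \<bullet> v)) (at y)"
    and dG: "\<forall>y\<in>V. (G has_derivative (\<lambda>v. H y *v v)) (at y)"
    and "continuous_on V H" and G0: "\<forall>y\<in>V. G y \<noteq> 0"
    and fr: "frontier K \<inter> V = {y\<in>V. F y = 0}"
    and c: "c \<in> {-1, 1::real}" and \<nu>: "\<forall>y\<in>frontier K \<inter> V. gauss_map K y = c *\<^sub>R (G y /\<^sub>R norm (G y))"
    by (rule C2_plus_gauss_map_local[OF K x])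
  show ?thesis
    by (rule that, rule gauss_map_has_derivative[OF V x bspec[OF dG V(2)] bspec[OF G0 V(2)] \<nu>])
qed

text \<open>\<open>frechet_derivative\<close> picks an arbitrary derivative within the frontier. The
  projection in the definition feeds it tangent vectors only, and there it agrees with any other
  derivative \<open>D\<close>.\<close>

lemma gauss_curvature_eq:
  fixes K :: "(real^'n) set"
  assumes D: "(gauss_map K has_derivative D) (at x within frontier K)" and x: "x \<in> frontier K"
    and u: "gauss_map K x = u" "norm u = 1"
    and t: "\<And>v. v \<bullet> u = 0 \<Longrightarrow> tangent_vector (frontier K) x v"
  shows "gauss_curvature K x = det (matrix (\<lambda>v. D (v - (v \<bullet> u) *\<^sub>R u) + (v \<bullet> u) *\<^sub>R u))"
proof -
  have F: "(gauss_map K has_derivative frechet_derivative (gauss_map K) (at x within frontier K))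
      (at x within frontier K)"
    using D by (auto simp: frechet_derivative_works[symmetric] differentiable_def)
  have "frechet_derivative (gauss_map K) (at x within frontier K) (v - (v \<bullet> u) *\<^sub>R u)
      = D (v - (v \<bullet> u) *\<^sub>R u)" for v
    by (rule has_derivative_tangent_unique[OF F D x t])
      (use u in \<open>simp add: inner_diff_left norm_eq_1\<close>)
  thus ?thesis unfolding gauss_curvature_def Let_def u(1) by simp
qed

text \<open>Differentiate the constant squared norm of the normal. So the Weingarten map takes the
  tangent space into itself, on which the factorization for linear images relies.\<close>

lemma gauss_map_derivative_orthogonal:
  fixes K :: "(real^'n) set"
  assumes K: "C2_plus K" and x: "x \<in> frontier K"
    and D: "(gauss_map K has_derivative D) (at x within frontier K)"
    and v: "v \<bullet> gauss_map K x = 0"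
  shows "D v \<bullet> gauss_map K x = 0"
proof -
  have "((\<lambda>y. gauss_map K y \<bullet> gauss_map K y) has_derivative
      (\<lambda>v. gauss_map K x \<bullet> D v + D v \<bullet> gauss_map K x)) (at x within frontier K)"
    by (rule has_derivative_inner[OF D D])
  from has_derivative_tangent_zero[OF this x tangent_vector_frontier[OF K x v]]
  show ?thesis using norm_gauss_map[OF K] x by (simp add: norm_eq_1 inner_commute)
qed

lemma continuous_on_det:
  fixes A :: "'a::topological_space \<Rightarrow> real^'n^'n"
  assumes "\<And>i j. continuous_on S (\<lambda>x. A x $ i $ j)"
  shows "continuous_on S (\<lambda>x. det (A x))"
  unfolding det_def by (intro continuous_intros assms)

lemma continuous_on_locally:
  fixes f :: "'a::metric_space \<Rightarrow> 'b::topological_space"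
  assumes "\<And>x. x \<in> S \<Longrightarrow> \<exists>V. open V \<and> x \<in> V \<and> continuous_on (S \<inter> V) f"
  shows "continuous_on S f"
  unfolding continuous_on_eq_continuous_within
proof
  fix x assume x: "x \<in> S"
  then obtain V where V: "open V" "x \<in> V" "continuous_on (S \<inter> V) f" using assms by blast
  hence "continuous (at x within S \<inter> V) f"
    using x unfolding continuous_on_eq_continuous_within by blast
  moreover have "at x within S \<inter> V = at x within S"
    by (rule at_within_nhd[OF V(2,1)]) auto
  ultimately show "continuous (at x within S) f" by simp
qed

text \<open>Near each point the curvature is the determinant of a matrix whose entries are
  continuous in the gradient, the Hessian and the normal. Continuity of the Hessian is what the
  second order smoothness supplies.\<close>

lemma continuous_on_gauss_curvature:
  fixes K :: "(real^'n) set"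
  assumes K: "C2_plus K"
  shows "continuous_on (frontier K) (gauss_curvature K)"
proof (rule continuous_on_locally)
  fix x assume x: "x \<in> frontier K"
  obtain V F G H c where V: "open V" "x \<in> V"
    and dF: "\<forall>y\<in>V. (F has_derivative (\<lambda>v. G y \<bullet> v)) (at y)"
    and dG: "\<forall>y\<in>V. (G has_derivative (\<lambda>v. H y *v v)) (at y)"
    and cH: "continuous_on V H" and G0: "\<forall>y\<in>V. G y \<noteq> 0"
    and fr: "frontier K \<inter> V = {y\<in>V. F y = 0}"
    and c: "c \<in> {-1, 1::real}" and \<nu>: "\<forall>y\<in>frontier K \<inter> V. gauss_map K y = c *\<^sub>R (G y /\<^sub>R norm (G y))"
    by (rule C2_plus_gauss_map_local[OF K x])
  let ?S = "frontier K \<inter> V"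
  have cG: "continuous_on V G"
    using dG has_derivative_continuous continuous_at_imp_continuous_on by blast
  have cH': "continuous_on ?S H" and cG': "continuous_on ?S G"
    and cn: "continuous_on ?S (gauss_map K)"
    using continuous_on_subset[OF cH] continuous_on_subset[OF cG]
      continuous_on_subset[OF continuous_on_gauss_map[OF K]] by auto
  let ?A = "\<lambda>y v. normal_derivative c (G y) (H y) (v - (v \<bullet> gauss_map K y) *\<^sub>R gauss_map K y)
      + (v \<bullet> gauss_map K y) *\<^sub>R gauss_map K y"
  have eq: "gauss_curvature K y = det (matrix (?A y))" if "y \<in> ?S" for y
  proof -
    have y: "y \<in> frontier K" "y \<in> V" using that by auto
    show ?thesis
      by (rule gauss_curvature_eq[OF gauss_map_has_derivative[OF V(1) y(2,1)
              bspec[OF dG y(2)] bspec[OF G0 y(2)] \<nu>] y(1) refl norm_gauss_map[OF K y(1)]])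
        (rule tangent_vector_frontier[OF K y(1)])
  qed
  have mv: "continuous_on ?S (\<lambda>y. H y *v w y)" if "continuous_on ?S w" for w :: "_ \<Rightarrow> real^'n"
    unfolding matrix_vector_mult_def
    by (intro continuous_on_vec_lambda continuous_intros cH' that)
  have "continuous_on ?S (\<lambda>y. matrix (?A y) $ i $ j)" for i j
    unfolding matrix_def normal_derivative_def
    by (simp, intro continuous_intros mv cn cG') (use G0 in auto)
  hence "continuous_on ?S (\<lambda>y. det (matrix (?A y)))" by (rule continuous_on_det)
  hence "continuous_on ?S (gauss_curvature K)" 
    by (rule continuous_on_eq) (use eq in auto)
  thus "\<exists>V. open V \<and> x \<in> V \<and> continuous_on (frontier K \<inter> V) (gauss_curvature K)"
    using V by blast
qed

text \<open>A segment in the boundary would be a direction in which the Gauss map is constant, so the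
  curvature would vanish there.\<close>

lemma C2_plus_boundary_point_unique:
  fixes K :: "(real^'n) set"
  assumes K: "C2_plus K" and x: "x \<in> frontier K" "outer_unit_normal K x u"
    and y: "y \<in> frontier K" "outer_unit_normal K y u"
  shows "x = y"
proof (rule ccontr)
  assume "x \<noteq> y"
  define v where "v = y - x"
  have v0: "v \<noteq> 0" using \<open>x \<noteq> y\<close> by (simp add: v_def)
  have cb: "convex_body K" and kpos: "gauss_curvature K x > 0"
    using K x by (auto simp: C2_plus_def)
  have xK: "x \<in> K" and yK: "y \<in> K" using convex_body_frontier_subset[OF cb] x y by auto
  \<comment> \<open>Both \<open>x\<close> and \<open>y\<close> maximize the inner product with
    \<open>u\<close> over \<open>K\<close>.\<close>
  have vu: "v \<bullet> u = 0"
    using x(2) y(2) xK yK unfolding outer_unit_normal_def v_def inner_diff_left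
    by (simp add: antisym)
  have gx: "gauss_map K x = u" by (rule C2_plus_gauss_map_eq[OF K x])
  have nu: "norm u = 1" using x(2) by (simp add: outer_unit_normal_def)
  \<comment> \<open>On \<open>S\<close> the Gauss map is constant, so its derivative kills tangent
    vectors of \<open>S\<close>. The segment from \<open>x\<close> to \<open>y\<close> lies in
    \<open>S\<close> and makes \<open>v\<close> such a vector.\<close>
  define S where "S = {z \<in> frontier K. gauss_map K z = u}"
  have xS: "x \<in> S" using x gx by (simp add: S_def)
  have "x + t *\<^sub>R v \<in> S" if t: "0 < t" "t \<le> 1" for t
  proof -
    have "x + t *\<^sub>R v = (1 - t) *\<^sub>R x + t *\<^sub>R y" by (simp add: v_def algebra_simps)
    hence zK: "x + t *\<^sub>R v \<in> K"
      using cb xK yK t by (auto simp: convex_body_def convex_alt)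
    have "outer_unit_normal K (x + t *\<^sub>R v) u"
      using x(2) vu by (simp add: outer_unit_normal_def inner_add_left)
    thus ?thesis using outer_unit_normal_frontier[OF zK] C2_plus_gauss_map_eq[OF K]
      by (simp add: S_def)
  qed
  hence tv: "tangent_vector S x v" by (rule tangent_vector_segment)
  obtain D where D: "(gauss_map K has_derivative D) (at x within frontier K)"
    by (rule gauss_map_differentiable[OF K x(1)])
  have "(gauss_map K has_derivative D) (at x within S)"
    using D by (rule has_derivative_subset) (auto simp: S_def)
  from has_derivative_tangent_zero[OF this xS tv] have Dv: "D v = 0"
    using gx by (auto simp: S_def)
  let ?A = "\<lambda>v. D (v - (v \<bullet> u) *\<^sub>R u) + (v \<bullet> u) *\<^sub>R u"
  have "linear D" using D has_derivative_linear by blast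
  hence lin: "linear ?A"
    by (intro linearI) (simp_all add: linear_diff linear_add linear_scale algebra_simps)
  have "det (matrix ?A) \<noteq> 0"
    using gauss_curvature_eq[OF D x(1) gx nu] tangent_vector_frontier[OF K x(1)] kpos gx by simp
  hence "inj ?A" using det_nz_iff_inj[OF lin] by simp
  moreover have "?A v = 0" using Dv vu by simp
  ultimately show False using v0 lin linear_injective_0 by blast
qed

section \<open>The inverse of the Gauss map; curvature and support function on the sphere\<close>

definition boundary_point :: "(real^'n) set \<Rightarrow> real^'n \<Rightarrow> real^'n" where
  "boundary_point K u = (THE x. x \<in> frontier K \<and> outer_unit_normal K x u)"

lemma boundary_point_eq:
  assumes "C2_plus K" "x \<in> frontier K" "outer_unit_normal K x u"
  shows "boundary_point K u = x"
  unfolding boundary_point_def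
  using C2_plus_boundary_point_unique[OF assms(1)] assms by (intro the_equality) auto

lemma boundary_point:
  fixes K :: "(real^'n) set"
  assumes K: "C2_plus K" and u: "norm u = 1"
  shows "boundary_point K u \<in> frontier K" "outer_unit_normal K (boundary_point K u) u"
proof -
  have "convex_body K" using K by (simp add: C2_plus_def)
  then obtain x where "x \<in> frontier K" "outer_unit_normal K x u"
    using outer_unit_normal_exists_point u by blast
  with boundary_point_eq[OF K this]
  show "boundary_point K u \<in> frontier K" "outer_unit_normal K (boundary_point K u) u" by auto
qed

lemma continuous_on_boundary_point:
  fixes K :: "(real^'n) set"
  assumes K: "C2_plus K"
  shows "continuous_on (sphere 0 1) (boundary_point K)"
proof -
  have "gauss_map K ` frontier K = sphere 0 1"
  proof
    show "gauss_map K ` frontier K \<subseteq> sphere 0 1" using norm_gauss_map[OF K] by auto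
    show "sphere 0 1 \<subseteq> gauss_map K ` frontier K"
      using boundary_point[OF K] C2_plus_gauss_map_eq[OF K] by (auto simp: image_iff) metis
  qed
  moreover have "compact (frontier K)"
    using K by (simp add: C2_plus_def convex_body_def compact_frontier)
  moreover have "\<forall>x\<in>frontier K. boundary_point K (gauss_map K x) = x"
    using C2_plus_gauss_map[OF K] boundary_point_eq[OF K] by blast
  ultimately show ?thesis using continuous_on_inv[OF continuous_on_gauss_map[OF K]] by metis
qed

lemma curvature_function_alt:
  "curvature_function K u = 1 / gauss_curvature K (boundary_point K u)"
  by (simp add: curvature_function_def boundary_point_def)

lemma curvature_function_pos:
  fixes K :: "(real^'n) set"
  assumes "C2_plus K" "norm u = 1"
  shows "curvature_function K u > 0"
  using assms boundary_point(1)[OF assms] by (simp add: curvature_function_alt C2_plus_def)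

lemma continuous_on_curvature_function:
  fixes K :: "(real^'n) set"
  assumes K: "C2_plus K"
  shows "continuous_on (sphere 0 1) (curvature_function K)"
proof -
  have "continuous_on (sphere 0 1) (\<lambda>u. gauss_curvature K (boundary_point K u))"
    by (rule continuous_on_compose2[OF continuous_on_gauss_curvature[OF K]
          continuous_on_boundary_point[OF K]]) (use boundary_point(1)[OF K] in auto)
  moreover have "gauss_curvature K (boundary_point K u) \<noteq> 0" if "u \<in> sphere 0 1" for u
    using curvature_function_pos[OF K, of u] that by (auto simp: curvature_function_alt)
  ultimately show ?thesis unfolding curvature_function_alt[abs_def]
    by (intro continuous_intros) auto
qed

lemma support_function_boundary_point:
  fixes K :: "(real^'n) set"
  assumes K: "C2_plus K" and u: "norm u = 1"
  shows "support_function K u = boundary_point K u \<bullet> u"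
proof -
  have "convex_body K" using K by (simp add: C2_plus_def)
  thus ?thesis
    using support_function_eq_outer_unit_normal[OF boundary_point(2)[OF K u]]
      boundary_point(1)[OF K u] convex_body_frontier_subset by blast
qed

lemma continuous_on_support_function:
  fixes K :: "(real^'n) set"
  assumes K: "C2_plus K"
  shows "continuous_on (sphere 0 1) (support_function K)"
proof -
  have "continuous_on (sphere 0 1) (\<lambda>u. boundary_point K u \<bullet> u)"
    by (intro continuous_intros continuous_on_boundary_point[OF K])
  thus ?thesis
    by (rule continuous_on_eq) (use support_function_boundary_point[OF K] in auto)
qed

lemma support_function_pos:
  fixes K :: "(real^'n) set"
  assumes K: "C2_plus K" and z: "0 \<in> interior K" and u: "norm u = 1"
  shows "support_function K u > 0"
proof -
  obtain e where e: "e > 0" "cball 0 e \<subseteq> K" using z by (auto simp: mem_interior_cball)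
  have "e *\<^sub>R u \<in> K" using e u by auto
  hence "(e *\<^sub>R u) \<bullet> u \<le> boundary_point K u \<bullet> u"
    using boundary_point(2)[OF K u] by (auto simp: outer_unit_normal_def)
  moreover have "(e *\<^sub>R u) \<bullet> u = e" using u by (simp add: norm_eq_1)
  ultimately show ?thesis using e support_function_boundary_point[OF K u] by simp
qed

section \<open>Linear images\<close>

locale linear_automorphism =
  fixes T :: "real^'n \<Rightarrow> real^'n"
  assumes lin: "linear T" and bij: "bij T"
begin

text \<open>Since \<open>T y \<bullet> u = y \<bullet> adjoint T u\<close>, the vector
  \<open>u\<close> supports the image of \<open>K\<close> at \<open>T x\<close> exactly when the
  normalized \<open>adjoint T u\<close> supports \<open>K\<close> at \<open>x\<close>.\<close>

definition pullback_normal :: "real^'n \<Rightarrow> real^'n" where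
  "pullback_normal u = adjoint T u /\<^sub>R norm (adjoint T u)"

lemma inv_cancel: "inv T (T x) = x" "T (inv T x) = x"
  using bij by (simp_all add: bij_is_inj bij_is_surj surj_f_inv_f)

lemma linear_inv: "linear (inv T)"
  by (intro linearI inv_f_eq[OF bij_is_inj[OF bij]])
    (simp_all add: linear_add[OF lin] linear_scale[OF lin] inv_cancel)

lemma adjoint_inner: "adjoint T u \<bullet> x = u \<bullet> T x" "adjoint (inv T) u \<bullet> x = u \<bullet> inv T x"
  using adjoint_works[OF lin, of x u] adjoint_works[OF linear_inv, of x u]
  by (simp_all add: inner_commute)

lemma adjoint_cancel: "adjoint T (adjoint (inv T) u) = u" "adjoint (inv T) (adjoint T u) = u"
  by (rule vector_eq_ldot[THEN iffD1], simp add: adjoint_inner inner_commute[of _ u]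
        inner_commute[of _ "adjoint _ _"] inv_cancel)+

lemma linear_adjoints: "linear (adjoint T)" "linear (adjoint (inv T))"
  by (rule adjoint_linear, rule lin) (rule adjoint_linear, rule linear_inv)

lemma adjoint_nonzero: "u \<noteq> 0 \<Longrightarrow> adjoint T u \<noteq> 0" "u \<noteq> 0 \<Longrightarrow> adjoint (inv T) u \<noteq> 0"
  using adjoint_cancel linear_0 linear_adjoints by metis+

lemma norm_pullback_normal: "u \<noteq> 0 \<Longrightarrow> norm (pullback_normal u) = 1"
  using adjoint_nonzero by (simp add: pullback_normal_def)

text \<open>Normalizing the inverse transpose gives preimages. Surjectivity permits the change of
  variable under a supremum over the sphere.\<close>

lemma pullback_normal_image: "pullback_normal ` sphere 0 1 = sphere 0 1"
proof
  show "pullback_normal ` sphere 0 1 \<subseteq> sphere 0 1"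
  proof
    fix w assume "w \<in> pullback_normal ` sphere 0 1"
    then obtain u where u: "norm u = 1" "w = pullback_normal u" by auto
    hence "u \<noteq> 0" by force
    thus "w \<in> sphere 0 1" using norm_pullback_normal u by simp
  qed
  show "sphere 0 1 \<subseteq> pullback_normal ` sphere 0 1"
  proof
    fix u :: "real^'n" assume "u \<in> sphere 0 1"
    hence u: "norm u = 1" by simp
    hence S0: "adjoint (inv T) u \<noteq> 0" using adjoint_nonzero(2)[of u] by force
    let ?u = "adjoint (inv T) u /\<^sub>R norm (adjoint (inv T) u)"
    have "pullback_normal ?u = u"
      using S0 u by (simp add: pullback_normal_def linear_scale[OF linear_adjoints(1)] adjoint_cancel)
    moreover have "?u \<in> sphere 0 1" using S0 by simp
    ultimately show "u \<in> pullback_normal ` sphere 0 1" by (metis image_eqI)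
  qed
qed

lemma frontier_image:
  assumes "compact K"
  shows "frontier (T ` K) = T ` frontier K"
proof -
  have "compact (T ` K)"
    using assms lin by (intro compact_continuous_image linear_continuous_on)
      (simp_all add: linear_conv_bounded_linear)
  thus ?thesis
    using assms bij by (simp add: frontier_def compact_imp_closed image_set_diff bij_is_inj
        interior_bijective_linear_image[OF lin bij])
qed

lemma outer_unit_normal_image:
  assumes u: "norm u = 1"
  shows "outer_unit_normal (T ` K) (T x) u \<longleftrightarrow> outer_unit_normal K x (pullback_normal u)"
proof -
  have a: "norm (adjoint T u) > 0" using adjoint_nonzero(1)[of u] u by force
  have "y \<bullet> pullback_normal u \<le> x \<bullet> pullback_normal u \<longleftrightarrow> T y \<bullet> u \<le> T x \<bullet> u" for y
    using a by (simp add: pullback_normal_def adjoint_works[OF lin] divide_simps)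
  moreover have "norm (pullback_normal u) = 1" using a by (simp add: pullback_normal_def)
  ultimately show ?thesis using u by (simp add: outer_unit_normal_def)
qed

section \<open>Support function and curvature of a linear image\<close>

context
  fixes K :: "(real^'n) set" and u :: "real^'n"
  assumes K: "C2_plus K" and u: "norm u = 1"
begin

lemma unit_nonzero: "u \<noteq> 0" using u by force

lemma compact_K: "compact K" and frontier_K: "frontier K \<subseteq> K"
  using K convex_body_frontier_subset by (auto simp: C2_plus_def convex_body_def)

lemma outer_unit_normal_boundary_point_image:
  "outer_unit_normal (T ` K) (T (boundary_point K (pullback_normal u))) u"
  using outer_unit_normal_image[OF u] boundary_point(2)[OF K norm_pullback_normal[OF unit_nonzero]] by simp

lemma support_function_image:
  "support_function (T ` K) u = norm (adjoint T u) * support_function K (pullback_normal u)"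
proof -
  let ?x = "boundary_point K (pullback_normal u)"
  have "?x \<in> K" using boundary_point(1)[OF K norm_pullback_normal[OF unit_nonzero]] frontier_K by blast
  hence "support_function (T ` K) u = T ?x \<bullet> u"
    using support_function_eq_outer_unit_normal[OF outer_unit_normal_boundary_point_image] by blast
  also have "\<dots> = norm (adjoint T u) * (?x \<bullet> pullback_normal u)"
    using adjoint_nonzero(1)[OF unit_nonzero] by (simp add: pullback_normal_def adjoint_works[OF lin])
  finally show ?thesis
    using support_function_boundary_point[OF K norm_pullback_normal[OF unit_nonzero]] by simp
qed

text \<open>Let \<open>u\<^sub>1\<close> be the pullback of \<open>u\<close>, \<open>r = |T\<^sup>\<top>u|\<close> and \<open>S\<close> the inverse transpose of \<open>T\<close>, so that
  \<open>r S u\<^sub>1 = u\<close>. The Gauss map of \<open>T K\<close> is the normalization of \<open>S \<nu>\<close>, with \<open>\<nu>\<close> the Gauss map of \<open>K\<close> at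
  the preimage. Hence the extended Weingarten map of \<open>T K\<close> factors as \<open>B A C\<close>, where \<open>A\<close> is that of \<open>K\<close>,
  \<open>C\<close> acts as the inverse of \<open>T\<close> on \<open>u\<^sup>\<bottom>\<close> and sends \<open>u\<close> to \<open>u\<^sub>1\<close>, and \<open>B\<close> acts on \<open>u\<^sub>1\<^sup>\<bottom>\<close> as \<open>r S\<close> followed
  by the projection onto \<open>u\<^sup>\<bottom>\<close> and sends \<open>u\<^sub>1\<close> to \<open>u\<close>. The outer factors are rank one perturbations
  of the inverse of \<open>T\<close> and of \<open>r S\<close>, with determinants \<open>r / det T\<close> and \<open>r\<^sup>n / det T\<close>.\<close>

lemma gauss_curvature_image:
  "gauss_curvature (T ` K) (T (boundary_point K (pullback_normal u)))
    = gauss_curvature K (boundary_point K (pullback_normal u))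
      * norm (adjoint T u) ^ (CARD('n) + 1) / (det (matrix T))\<^sup>2"
proof -
  define u1 where "u1 = pullback_normal u"
  define x where "x = boundary_point K u1"
  define r where "r = norm (adjoint T u)"
  define S where "S = adjoint (inv T)"
  define Ti where "Ti = inv T"
  have r: "r > 0" using adjoint_nonzero(1)[OF unit_nonzero] by (simp add: r_def)
  have nu1: "norm u1 = 1" unfolding u1_def by (rule norm_pullback_normal[OF unit_nonzero])
  have Ttu: "adjoint T u = r *\<^sub>R u1" using r by (simp add: u1_def pullback_normal_def r_def)
  have linS: "linear S" and linTi: "linear Ti"
    using linear_adjoints linear_inv by (simp_all add: S_def Ti_def)
  have SI: "S w \<bullet> v = w \<bullet> Ti v" for w v by (simp add: S_def Ti_def adjoint_inner)
  have "S (r *\<^sub>R u1) = u" unfolding Ttu[symmetric] by (simp add: S_def adjoint_cancel)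
  hence Su: "r *\<^sub>R S u1 = u" using linear_scale[OF linS] by simp
  hence Su1: "S u1 = u /\<^sub>R r" using r by auto
  have x: "x \<in> frontier K" "outer_unit_normal K x u1"
    using boundary_point[OF K nu1] by (simp_all add: x_def)
  have gx: "gauss_map K x = u1" by (rule C2_plus_gauss_map_eq[OF K x])
  have TiT: "Ti (T y) = y" "T (Ti y) = y" for y by (simp_all add: Ti_def inv_cancel)
  have fr: "frontier (T ` K) = T ` frontier K" by (rule frontier_image[OF compact_K])
  \<comment> \<open>Uniqueness of the normals of the image is inherited from \<open>K\<close>: a
    normal \<open>v\<close> of the image pulls back to \<open>w\<close>, which forces
    \<open>v\<close> to be the normalization of \<open>S w\<close>.\<close>
  have gT: "gauss_map (T ` K) y = S (gauss_map K (Ti y)) /\<^sub>R norm (S (gauss_map K (Ti y)))"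
    if y: "y \<in> T ` frontier K" for y
  proof -
    obtain z where z: "z \<in> frontier K" "y = T z" using y by blast
    define w where "w = gauss_map K z"
    have nw: "norm w = 1" using norm_gauss_map[OF K z(1)] by (simp add: w_def)
    have Sw: "S w \<noteq> 0" using adjoint_nonzero(2)[of w] nw unfolding S_def by force
    have pw: "pullback_normal (S w /\<^sub>R norm (S w)) = w"
      using Sw nw unfolding pullback_normal_def
      by (simp add: linear_scale[OF linear_adjoints(1)] S_def adjoint_cancel)
    have "gauss_map (T ` K) (T z) = S w /\<^sub>R norm (S w)"
    proof (rule gauss_map_eqI)
      show "outer_unit_normal (T ` K) (T z) (S w /\<^sub>R norm (S w))"
        using outer_unit_normal_image[of "S w /\<^sub>R norm (S w)" K z] Sw pw
          C2_plus_gauss_map[OF K z(1)] by (simp add: w_def)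
    next
      fix v assume v: "outer_unit_normal (T ` K) (T z) v"
      hence nv: "norm v = 1" by (simp add: outer_unit_normal_def)
      hence v0: "v \<noteq> 0" by force
      have "pullback_normal v = w"
        using outer_unit_normal_image[OF nv, of K z] v C2_plus_gauss_map_eq[OF K z(1)]
        by (simp add: w_def)
      hence "adjoint T v = norm (adjoint T v) *\<^sub>R w"
        using adjoint_nonzero(1)[OF v0] by (auto simp: pullback_normal_def)
      hence "v = norm (adjoint T v) *\<^sub>R S w"
        using adjoint_cancel(2)[of v] linear_scale[OF linS] by (metis S_def)
      moreover from this have "1 = norm (adjoint T v) * norm (S w)"
        using nv by (metis abs_norm_cancel norm_scaleR)
      ultimately show "v = S w /\<^sub>R norm (S w)" using Sw by (metis inverse_unique mult.commute)
    qed
    thus ?thesis by (simp add: z TiT w_def)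
  qed
  obtain D where D: "(gauss_map K has_derivative D) (at x within frontier K)"
    by (rule gauss_map_differentiable[OF K x(1)])
  \<comment> \<open>The chain rule for normalization at \<open>S u1 = u /\<^sub>R r\<close>, a
    vector of norm \<open>1 / r\<close>: it contributes the factor \<open>r\<close> and the
    projection onto the complement of \<open>u\<close>.\<close>
  define D' where "D' = (\<lambda>v. r *\<^sub>R (S (D (Ti v)) - (u \<bullet> S (D (Ti v))) *\<^sub>R u))"
  have D': "(gauss_map (T ` K) has_derivative D') (at (T x) within frontier (T ` K))"
    unfolding fr
  proof (rule has_derivative_transform[OF _ gT])
    show "T x \<in> T ` frontier K" using x by blast
    have Ti': "(Ti has_derivative Ti) (at (T x) within T ` frontier K)"
      using linTi by (simp add: linear_imp_has_derivative)
    have im: "Ti ` T ` frontier K = frontier K" by (simp add: image_comp o_def TiT)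
    have "((\<lambda>y. gauss_map K (Ti y)) has_derivative (\<lambda>v. D (Ti v))) (at (T x) within T ` frontier K)"
      by (rule has_derivative_in_compose[OF Ti']) (simp add: im TiT D)
    from has_derivative_compose[OF this linear_imp_has_derivative[OF linS]]
    have *: "((\<lambda>y. S (gauss_map K (Ti y))) has_derivative (\<lambda>v. S (D (Ti v))))
        (at (T x) within T ` frontier K)" .
    have Sg: "S (gauss_map K (Ti (T x))) = u /\<^sub>R r" using gx Su1 by (simp add: TiT)
    have "u /\<^sub>R r \<noteq> 0" using r unit_nonzero by simp
    from has_derivative_compose[OF * has_derivative_normalize[OF this[folded Sg]]]
    have "((\<lambda>y. S (gauss_map K (Ti y)) /\<^sub>R norm (S (gauss_map K (Ti y)))) has_derivative
       (\<lambda>v. S (D (Ti v)) /\<^sub>R norm (u /\<^sub>R r)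
          - (((u /\<^sub>R r) \<bullet> S (D (Ti v))) / norm (u /\<^sub>R r) ^ 3) *\<^sub>R (u /\<^sub>R r)))
       (at (T x) within T ` frontier K)" unfolding Sg .
    moreover have "S (D (Ti v)) /\<^sub>R norm (u /\<^sub>R r)
          - (((u /\<^sub>R r) \<bullet> S (D (Ti v))) / norm (u /\<^sub>R r) ^ 3) *\<^sub>R (u /\<^sub>R r) = D' v" for v
      using r u by (simp add: D'_def scaleR_diff_right power3_eq_cube divide_inverse)
    ultimately show "((\<lambda>y. S (gauss_map K (Ti y)) /\<^sub>R norm (S (gauss_map K (Ti y))))
        has_derivative D') (at (T x) within T ` frontier K)" by (simp only:)
  qed
  have Tiu1: "Ti v \<bullet> u1 = (v \<bullet> u) / r" for v
  proof -
    have "Ti v \<bullet> adjoint T u = v \<bullet> u" by (simp add: adjoint_works[OF lin] TiT)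
    thus ?thesis using r by (simp add: Ttu field_simps)
  qed
  have tan: "tangent_vector (frontier (T ` K)) (T x) v" if "v \<bullet> u = 0" for v
  proof -
    have "Ti v \<bullet> gauss_map K x = 0" using that by (simp add: gx Tiu1)
    from tangent_vector_linear_image[OF linear_conv_bounded_linear[THEN iffD1, OF lin]
        tangent_vector_frontier[OF K x(1) this]]
    show ?thesis by (simp add: fr TiT)
  qed
  have gTx: "gauss_map (T ` K) (T x) = u"
  proof -
    have "gauss_map (T ` K) (T x) = (u /\<^sub>R r) /\<^sub>R norm (u /\<^sub>R r)"
      using gT[of "T x"] x by (simp add: TiT gx Su1)
    thus ?thesis using r u by simp
  qed
  have Tx: "T x \<in> frontier (T ` K)" using x fr by blast
  have k': "gauss_curvature (T ` K) (T x)
      = det (matrix (\<lambda>v. D' (v - (v \<bullet> u) *\<^sub>R u) + (v \<bullet> u) *\<^sub>R u))"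
    by (rule gauss_curvature_eq[OF D' Tx gTx u tan])
  define A where "A = (\<lambda>v. D (v - (v \<bullet> u1) *\<^sub>R u1) + (v \<bullet> u1) *\<^sub>R u1)"
  have k: "gauss_curvature K x = det (matrix A)" unfolding A_def
    by (rule gauss_curvature_eq[OF D x(1) gx nu1]) (use tangent_vector_frontier[OF K x(1)] gx in simp)
  \<comment> \<open>\<open>q\<close> is \<open>r\<close> times the projection of \<open>Ti u\<close>
    onto the complement of \<open>u1\<close>. Hence \<open>B1\<close> fixes \<open>u1\<close>, and
    \<open>q \<bullet> z = r * (u \<bullet> S z)\<close> for \<open>z\<close> orthogonal to
    \<open>u1\<close>, which is the normal component that \<open>D'\<close> removes.\<close>
  define q where "q = r *\<^sub>R (Ti u - (Ti u \<bullet> u1) *\<^sub>R u1)"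
  \<comment> \<open>\<open>C1\<close> fixes the complement of \<open>u\<close> and sends
    \<open>u\<close> to \<open>T u1\<close>, so \<open>Ti \<circ> C1\<close> sends \<open>u\<close>
    to \<open>u1\<close>.\<close>
  define C1 where "C1 = (\<lambda>v. v + (u \<bullet> v) *\<^sub>R (T u1 - u))"
  define B1 where "B1 = (\<lambda>v. v + ((- q) \<bullet> v) *\<^sub>R u1)"
  have linD: "linear D" using D by (rule has_derivative_linear)
  have linA: "linear A" unfolding A_def
    using linD by (intro linearI) (simp_all add: linear_diff linear_add linear_scale algebra_simps)
  have linC1: "linear C1" and linB1: "linear B1"
    unfolding C1_def B1_def by (intro linearI; simp add: algebra_simps)+
  have linr: "linear ((*\<^sub>R) r :: real^'n \<Rightarrow> real^'n)" by (rule linear_scaleR)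
  have u11: "u1 \<bullet> u1 = 1" and uu: "u \<bullet> u = 1" using nu1 u by (simp_all add: norm_eq_1)
  have fact: "(\<lambda>v. D' (v - (v \<bullet> u) *\<^sub>R u) + (v \<bullet> u) *\<^sub>R u) = S \<circ> ((*\<^sub>R) r \<circ> (B1 \<circ> (A \<circ> (Ti \<circ> C1))))"
  proof
    fix v
    define a where "a = v \<bullet> u"
    define p where "p = v - a *\<^sub>R u"
    have pu: "p \<bullet> u = 0" using uu by (simp add: p_def a_def inner_diff_left)
    have "Ti (C1 v) = Ti (p + a *\<^sub>R T u1)"
      by (simp add: C1_def p_def a_def inner_commute algebra_simps)
    also have "\<dots> = Ti p + a *\<^sub>R u1"
      by (simp add: linear_add[OF linTi] linear_scale[OF linTi] TiT)
    finally have 1: "Ti (C1 v) = Ti p + a *\<^sub>R u1" .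
    have Tp: "Ti p \<bullet> u1 = 0" by (simp add: Tiu1 pu)
    define z where "z = D (Ti p)"
    have 2: "A (Ti p + a *\<^sub>R u1) = z + a *\<^sub>R u1"
      using Tp u11 by (simp add: A_def z_def inner_add_left)
    have zu: "z \<bullet> u1 = 0"
      using gauss_map_derivative_orthogonal[OF K x(1) D] Tp by (simp add: z_def gx)
    have uSz: "Ti u \<bullet> z = u \<bullet> S z" using SI[of z u] by (simp only: inner_commute)
    have u1z: "u1 \<bullet> z = 0" using zu by (simp only: inner_commute)
    have qz: "q \<bullet> z = r * (u \<bullet> S z)" by (simp add: q_def inner_diff_left u1z uSz)
    have qu: "q \<bullet> u1 = 0" by (simp add: q_def inner_diff_left u11)
    have 3: "B1 (z + a *\<^sub>R u1) = z + a *\<^sub>R u1 - (r * (u \<bullet> S z)) *\<^sub>R u1"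
      by (simp add: B1_def inner_add_right qz qu)
    have "S (r *\<^sub>R (z + a *\<^sub>R u1 - (r * (u \<bullet> S z)) *\<^sub>R u1))
        = r *\<^sub>R S z + a *\<^sub>R (r *\<^sub>R S u1) - (r * (u \<bullet> S z)) *\<^sub>R (r *\<^sub>R S u1)"
      by (simp add: linear_add[OF linS] linear_diff[OF linS] linear_scale[OF linS] algebra_simps)
    also have "\<dots> = D' p + a *\<^sub>R u"
      unfolding Su by (simp add: D'_def z_def algebra_simps)
    finally show "D' (v - (v \<bullet> u) *\<^sub>R u) + (v \<bullet> u) *\<^sub>R u = (S \<circ> ((*\<^sub>R) r \<circ> (B1 \<circ> (A \<circ> (Ti \<circ> C1))))) v"
      by (simp only: comp_apply 1 2 3 a_def[symmetric] p_def[symmetric])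
  qed
  have dC: "det (matrix C1) = r"
  proof -
    have "det (matrix C1) = 1 + (T u1 - u) \<bullet> u" unfolding C1_def by (rule det_plus_rank_one)
    also have "\<dots> = u1 \<bullet> adjoint T u" using uu by (simp add: inner_diff_left adjoint_works[OF lin])
    finally show ?thesis using u11 by (simp add: Ttu)
  qed
  have dB: "det (matrix B1) = 1"
  proof -
    have "det (matrix B1) = 1 + u1 \<bullet> (- q)" unfolding B1_def by (rule det_plus_rank_one)
    thus ?thesis using u11 by (simp add: q_def inner_diff_right inner_commute)
  qed
  have dS: "det (matrix S) = det (matrix Ti)"
    unfolding S_def Ti_def by (simp add: matrix_adjoint[OF linear_inv] det_transpose)
  have "matrix T ** matrix Ti = matrix (T \<circ> Ti)" by (rule matrix_compose[OF linTi lin, symmetric])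
  also have "T \<circ> Ti = id" by (auto simp: TiT)
  finally have "matrix T ** matrix Ti = mat 1" by (simp only: matrix_id_mat_1)
  hence "det (matrix T) * det (matrix Ti) = 1" by (metis det_I det_mul)
  hence dTi: "det (matrix Ti) = 1 / det (matrix T)" by (metis eq_divide_imp mult.commute mult_zero_left zero_neq_one)
  have "gauss_curvature (T ` K) (T x) = det (matrix S) * (r ^ CARD('n) * (det (matrix B1)
      * (det (matrix A) * (det (matrix Ti) * det (matrix C1)))))"
    unfolding k' fact
    by (simp add: matrix_compose linS linr linB1 linA linTi linC1 linear_compose det_mul det_matrix_scaleR)
  also have "\<dots> = gauss_curvature K x * r ^ (CARD('n) + 1) / (det (matrix T))\<^sup>2"
    by (simp add: dC dB dS dTi k power2_eq_square)
  finally show ?thesis unfolding x_def u1_def r_def .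
qed

lemma curvature_function_image:
  "curvature_function (T ` K) u = curvature_function K (pullback_normal u)
     * (det (matrix T))\<^sup>2 / norm (adjoint T u) ^ (CARD('n) + 1)"
proof -
  let ?x = "boundary_point K (pullback_normal u)"
  have x: "?x \<in> frontier K" "outer_unit_normal K ?x (pullback_normal u)"
    using boundary_point[OF K norm_pullback_normal[OF unit_nonzero]] by auto
  \<comment> \<open>Uniqueness of the boundary point with a given normal also passes from
    \<open>K\<close> to the image through the pullback.\<close>
  have "boundary_point (T ` K) u = T ?x"
    unfolding boundary_point_def[of "T ` K"]
  proof (rule the_equality)
    show "T ?x \<in> frontier (T ` K) \<and> outer_unit_normal (T ` K) (T ?x) u"
      using x outer_unit_normal_image[OF u] by (simp add: frontier_image[OF compact_K])
  next
    fix y assume y: "y \<in> frontier (T ` K) \<and> outer_unit_normal (T ` K) y u"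
    then obtain z where z: "z \<in> frontier K" "y = T z" by (auto simp: frontier_image[OF compact_K])
    hence "outer_unit_normal K z (pullback_normal u)" using y outer_unit_normal_image[OF u] by blast
    thus "y = T ?x" using boundary_point_eq[OF K z(1)] z(2) by simp
  qed
  thus ?thesis by (simp add: curvature_function_alt gauss_curvature_image)
qed

end

end

section \<open>The functions \<open>g\<^sub>K\<close> and the surface measure\<close>

definition neg_n_density :: "(real^'n) set \<Rightarrow> real^'n \<Rightarrow> real" where
  "neg_n_density K u = curvature_function K u powr (1 / (2 * real CARD('n))) *
     support_function K u powr ((real CARD('n) + 1) / (2 * real CARD('n)))"

lemma mixed_neg_n_density:
  fixes K :: "nat \<Rightarrow> (real^'n) set"
  shows "mixed_affine_surface_area_neg_n K
    = (SUP u\<in>sphere 0 1. \<Prod>i=1..CARD('n). neg_n_density (K i) u)"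
  by (simp add: mixed_affine_surface_area_neg_n_def neg_n_density_def)

lemma neg_n_density_nonneg: "neg_n_density K u \<ge> 0"
  by (simp add: neg_n_density_def)

lemma continuous_on_neg_n_density:
  fixes K :: "(real^'n) set"
  assumes K: "C2_plus K" and z: "0 \<in> interior K"
  shows "continuous_on (sphere 0 1) (neg_n_density K)"
proof -
  have "curvature_function K u \<noteq> 0" "support_function K u \<noteq> 0" if "u \<in> sphere 0 1" for u
    using curvature_function_pos[OF K, of u] support_function_pos[OF K z, of u] that by auto
  thus ?thesis unfolding neg_n_density_def[abs_def]
    by (intro continuous_intros continuous_on_curvature_function[OF K]
        continuous_on_support_function[OF K]) auto
qed

text \<open>The norm of \<open>adjoint T u\<close> enters the curvature function to the power -(n+1)
  and the support function to the power 1, so the exponents 1/(2n) and (n+1)/(2n) make it cancel.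
  Only the squared determinant to the power 1/(2n) remains.\<close>

lemma (in linear_automorphism) neg_n_density_image:
  assumes K: "C2_plus K" and z: "0 \<in> interior K" and u: "norm u = 1"
  shows "neg_n_density (T ` K) u
    = \<bar>det (matrix T)\<bar> powr (1 / real CARD('n)) * neg_n_density K (pullback_normal u)"
proof -
  define r where "r = norm (adjoint T u)"
  define f where "f = curvature_function K (pullback_normal u)"
  define h where "h = support_function K (pullback_normal u)"
  define N where "N = real CARD('n)"
  have u0: "u \<noteq> 0" using u by force
  have r: "r > 0" using adjoint_nonzero(1)[OF u0] by (simp add: r_def)
  have np: "norm (pullback_normal u) = 1" by (rule norm_pullback_normal[OF u0])
  have f: "f > 0" and h: "h > 0"
    using curvature_function_pos[OF K np] support_function_pos[OF K z np] by (simp_all add: f_def h_def)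
  have N: "N > 0" by (simp add: N_def)
  have d2: "(det (matrix T))\<^sup>2 = \<bar>det (matrix T)\<bar> powr 2"
    by (simp add: powr_numeral)
  have d3: "(det (matrix T))\<^sup>2 powr (1 / (2 * N)) = \<bar>det (matrix T)\<bar> powr (1 / N)"
    unfolding d2 powr_powr by simp
  have rp: "r ^ (CARD('n) + 1) = r powr (N + 1)" using r by (simp add: N_def powr_realpow[symmetric] powr_add)
  have "curvature_function (T ` K) u = f * \<bar>det (matrix T)\<bar> powr 2 / r powr (N + 1)"
    using curvature_function_image[OF K u] by (simp only: f_def[symmetric] r_def[symmetric] d2 rp)
  hence "curvature_function (T ` K) u powr (1 / (2 * N))
      = f powr (1 / (2 * N)) * \<bar>det (matrix T)\<bar> powr (1 / N) / r powr ((N + 1) / (2 * N))"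
    using f r by (simp add: powr_divide powr_mult powr_powr d3)
  moreover have "support_function (T ` K) u powr ((N + 1) / (2 * N))
      = r powr ((N + 1) / (2 * N)) * h powr ((N + 1) / (2 * N))"
    using support_function_image[OF K u] r h by (simp add: powr_mult r_def[symmetric] h_def[symmetric])
  ultimately show ?thesis
    using r by (simp add: neg_n_density_def N_def[symmetric] f_def[symmetric] h_def[symmetric])
qed

text \<open>A dilation by \<open>c\<close> fixes every normal and has determinant c^n.\<close>

lemma neg_n_density_dilate:
  fixes K :: "(real^'n) set"
  assumes K: "C2_plus K" and z: "0 \<in> interior K" and u: "norm u = 1" and c: "c > 0"
  shows "neg_n_density ((\<lambda>x. c *\<^sub>R x) ` K) u = c * neg_n_density K u"
proof -
  interpret linear_automorphism "\<lambda>x::real^'n. c *\<^sub>R x"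
  proof (rule linear_automorphism.intro)
    show "linear (\<lambda>x::real^'n. c *\<^sub>R x)" by (rule linear_scaleR)
    show "bij (\<lambda>x::real^'n. c *\<^sub>R x)"
      by (rule bij_betw_byWitness[where f' = "\<lambda>x. x /\<^sub>R c"]) (use c in auto)
  qed
  have "adjoint (\<lambda>x::real^'n. c *\<^sub>R x) = (\<lambda>x. c *\<^sub>R x)" by (rule adjoint_unique) simp
  hence "pullback_normal u = u" using u c by (simp add: pullback_normal_def)
  moreover have "\<bar>det (matrix (\<lambda>x::real^'n. c *\<^sub>R x))\<bar> powr (1 / real CARD('n)) = c"
    using c by (simp add: powr_realpow[symmetric] powr_powr)
  ultimately show ?thesis using neg_n_density_image[OF K z u] by simp
qed

section \<open>Attained suprema of continuous functions\<close>

lemma compact_attains_SUP: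
  fixes F :: "'a::topological_space \<Rightarrow> real"
  assumes "compact A" "A \<noteq> {}" "continuous_on A F"
  obtains x where "x \<in> A" "(SUP x\<in>A. F x) = F x" "\<forall>y\<in>A. F y \<le> F x"
proof -
  obtain x where x: "x \<in> A" "\<And>y. y \<in> A \<Longrightarrow> F y \<le> F x"
    using continuous_attains_sup[OF assms] by blast
  moreover from this have "(SUP x\<in>A. F x) = F x" by (intro cSup_eq_maximum) auto
  ultimately show ?thesis using that by blast
qed

lemma SUP_mult_left_compact:
  fixes F :: "'a::topological_space \<Rightarrow> real"
  assumes "compact A" "A \<noteq> {}" "continuous_on A F" "c \<ge> 0"
  shows "(SUP x\<in>A. c * F x) = c * (SUP x\<in>A. F x)"
proof -
  obtain x where "x \<in> A" "(SUP x\<in>A. F x) = F x" "\<forall>y\<in>A. F y \<le> F x"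
    by (rule compact_attains_SUP[OF assms(1-3)])
  thus ?thesis using assms(4) by (auto intro!: cSup_eq_maximum mult_left_mono)
qed

section \<open>Integration over the sphere\<close>

lemma sphere_nonempty: "sphere (0::real^'n) 1 \<noteq> {}"
  using norm_axis_1 by (metis empty_iff mem_sphere_0)

lemma space_sphere_measure: "space (sphere_measure :: (real^'n) measure) = sphere 0 1"
  by (simp add: sphere_measure_def space_scale_measure space_restrict_space)

lemma sets_sphere_measure:
  "sets (sphere_measure :: (real^'n) measure) = sets (restrict_space borel (sphere 0 1))"
  by (simp add: sphere_measure_def sets_scale_measure)

lemma finite_measure_sphere_measure: "finite_measure (sphere_measure :: (real^'n) measure)"
proof
  let ?M = "restrict_space lborel (cball 0 1 - {0}) :: (real^'n) measure"
  let ?N = "restrict_space borel (sphere 0 1) :: (real^'n) measure"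
  let ?f = "\<lambda>x::real^'n. x /\<^sub>R norm x"
  \<comment> \<open>With the origin removed from the ball, the radial projection is
    continuous.\<close>
  have "?f \<in> borel_measurable (restrict_space borel (cball 0 1 - {0}))"
    by (intro borel_measurable_continuous_on_restrict continuous_intros) auto
  hence "?f \<in> borel_measurable ?M"
    by (simp cong: measurable_cong_sets add: sets_restrict_space)
  hence f: "?f \<in> measurable ?M ?N"
    by (intro measurable_restrict_space2) (auto simp: space_restrict_space)
  have "emeasure (distr ?M ?N ?f) (sphere 0 1) = emeasure ?M (?f -` sphere 0 1 \<inter> space ?M)"
    by (rule emeasure_distr[OF f]) (auto simp: sets_restrict_space)
  also have "\<dots> \<le> emeasure ?M (space ?M)" by (rule emeasure_space)
  also have "\<dots> = emeasure lborel (cball 0 1 - {0::real^'n})"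
    by (simp add: emeasure_restrict_space space_restrict_space)
  also have "\<dots> < \<infinity>" by (rule emeasure_bounded_finite) (auto intro: bounded_subset[OF bounded_cball])
  finally have "emeasure (distr ?M ?N ?f) (sphere 0 1) < \<infinity>" .
  thus "emeasure (sphere_measure :: (real^'n) measure) (space sphere_measure) \<noteq> \<infinity>"
    unfolding space_sphere_measure by (simp add: sphere_measure_def ennreal_mult_eq_top_iff less_top[symmetric]
        of_nat_less_top)
qed

lemma integrable_sphere_measure:
  fixes F :: "real^'n \<Rightarrow> real"
  assumes F: "continuous_on (sphere 0 1) F"
  shows "integrable sphere_measure F"
proof -
  have "bounded (F ` sphere 0 1)"
    by (intro compact_imp_bounded compact_continuous_image F compact_sphere)
  then obtain B where B: "\<And>u. u \<in> sphere 0 1 \<Longrightarrow> norm (F u) \<le> B" unfolding bounded_iff by blast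
  have "F \<in> borel_measurable (restrict_space borel (sphere 0 1))"
    by (rule borel_measurable_continuous_on_restrict[OF F])
  hence "F \<in> borel_measurable sphere_measure"
    using measurable_cong_sets[OF sets_sphere_measure refl] by blast
  thus ?thesis
    by (intro finite_measure.integrable_const_bound[OF finite_measure_sphere_measure, of _ B])
      (use B in \<open>auto intro!: AE_I2 simp: space_sphere_measure\<close>)
qed

section \<open>Mixed affine surface areas\<close>

text \<open>The last \<open>m\<close> factors are indexed as \<open>n - i\<close> with
  \<open>i < m\<close>, the indexing in which (ii) repeats the bodies.\<close>

lemma prod_last:
  fixes f :: "nat \<Rightarrow> real"
  assumes "m \<le> n"
  shows "(\<Prod>j=1..n. f j) = (\<Prod>j=1..n-m. f j) * (\<Prod>i=0..<m. f (n - i))"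
proof -
  have "{1..n} = {1..n-m} \<union> {n-m+1..n}" using assms by auto
  hence "(\<Prod>j=1..n. f j) = (\<Prod>j=1..n-m. f j) * (\<Prod>j=n-m+1..n. f j)"
    by (simp only:) (rule prod.union_disjoint, auto)
  also have "(\<Prod>j=n-m+1..n. f j) = (\<Prod>i=0..<m. f (n - i))"
    by (rule prod.reindex_bij_witness[of _ "\<lambda>i. n - i" "\<lambda>j. n - j"]) (use assms in auto)
  finally show ?thesis .
qed

text \<open>The centroid enters only as the origin being interior, which makes the support functions
  positive. Values of \<open>K\<close> outside the index range stay arbitrary.\<close>

locale centered_C2_plus_bodies =
  fixes K :: "nat \<Rightarrow> (real^'n) set"
  assumes C2: "i \<in> {1..CARD('n)} \<Longrightarrow> C2_plus (K i)"
    and zero: "i \<in> {1..CARD('n)} \<Longrightarrow> 0 \<in> interior (K i)"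
begin

definition replace_last :: "nat \<Rightarrow> nat \<Rightarrow> nat \<Rightarrow> (real^'n) set" where
  "replace_last m i = (\<lambda>j. if j \<le> CARD('n) - m then K j else K (CARD('n) - i))"

lemma continuous_density: "i \<in> {1..CARD('n)} \<Longrightarrow> continuous_on (sphere 0 1) (neg_n_density (K i))"
  using C2 zero continuous_on_neg_n_density by blast

text \<open>Each of the n bodies contributes the factor |det T|^(1/n), and the common pullback of
  the normal disappears when the supremum is reindexed over the sphere.\<close>

lemma mixed_linear_image:
  assumes T: "linear T" "bij T"
  shows "mixed_affine_surface_area_neg_n (\<lambda>i. T ` K i)
    = \<bar>det (matrix T)\<bar> * mixed_affine_surface_area_neg_n K"
proof -
  interpret linear_automorphism T using T by (rule linear_automorphism.intro)
  let ?P = "\<lambda>u. \<Prod>i=1..CARD('n). neg_n_density (K i) u"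
  let ?d = "\<bar>det (matrix T)\<bar>"
  have "det (matrix T) \<noteq> 0" using T by (simp add: det_nz_iff_inj bij_is_inj)
  hence d: "(?d powr (1 / real CARD('n))) ^ CARD('n) = ?d"
    by (simp add: powr_realpow[symmetric] powr_powr)
  have "(\<Prod>i=1..CARD('n). neg_n_density (T ` K i) u) = ?d * ?P (pullback_normal u)"
    if "u \<in> sphere 0 1" for u
  proof -
    have "(\<Prod>i=1..CARD('n). neg_n_density (T ` K i) u)
      = (\<Prod>i=1..CARD('n). ?d powr (1 / real CARD('n)) * neg_n_density (K i) (pullback_normal u))"
      by (intro prod.cong refl neg_n_density_image C2 zero) (use that in auto)
    thus ?thesis by (simp add: prod.distrib d)
  qed
  hence "mixed_affine_surface_area_neg_n (\<lambda>i. T ` K i)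
      = (SUP u\<in>sphere 0 1. ?d * ?P (pullback_normal u))"
    unfolding mixed_neg_n_density by (intro SUP_cong refl) auto
  also have "\<dots> = (SUP v\<in>pullback_normal ` sphere 0 1. ?d * ?P v)"
    by (simp add: image_comp o_def)
  also have "\<dots> = ?d * (SUP u\<in>sphere 0 1. ?P u)"
    unfolding pullback_normal_image
    by (intro SUP_mult_left_compact compact_sphere sphere_nonempty continuous_intros
        continuous_density) auto
  finally show ?thesis by (simp only: mixed_neg_n_density)
qed

lemma density_replace_last:
  assumes m: "m \<le> CARD('n)"
  shows "(\<Prod>j=1..CARD('n). neg_n_density (replace_last m i j) u)
    = (\<Prod>j=1..CARD('n)-m. neg_n_density (K j) u) * neg_n_density (K (CARD('n) - i)) u ^ m"
proof -
  have "replace_last m i (CARD('n) - k) = K (CARD('n) - i)" if "k < m" for k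
  proof -
    have "\<not> CARD('n) - k \<le> CARD('n) - m" using that m by linarith
    thus ?thesis unfolding replace_last_def by (rule if_not_P)
  qed
  hence "(\<Prod>k=0..<m. neg_n_density (replace_last m i (CARD('n) - k)) u)
      = (\<Prod>k=0..<m. neg_n_density (K (CARD('n) - i)) u)"
    by (intro prod.cong refl) simp
  moreover have "(\<Prod>j=1..CARD('n)-m. neg_n_density (replace_last m i j) u)
      = (\<Prod>j=1..CARD('n)-m. neg_n_density (K j) u)"
    by (intro prod.cong refl) (simp add: replace_last_def)
  ultimately show ?thesis
    unfolding prod_last[OF m] by (simp only: prod_constant card_atLeastLessThan diff_zero)
qed

lemma mixed_power_le:
  assumes m: "m \<le> CARD('n)"
  shows "mixed_affine_surface_area_neg_n K ^ m
    \<le> (\<Prod>i=0..<m. mixed_affine_surface_area_neg_n (replace_last m i))"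
proof -
  let ?g = "\<lambda>i. neg_n_density (K i)"
  have "continuous_on (sphere 0 1) (\<lambda>u. \<Prod>i=1..CARD('n). ?g i u)"
    by (intro continuous_intros continuous_density)
  from compact_attains_SUP[OF compact_sphere sphere_nonempty this]
  obtain u where u: "u \<in> sphere 0 1" "mixed_affine_surface_area_neg_n K = (\<Prod>i=1..CARD('n). ?g i u)"
    unfolding mixed_neg_n_density by blast
  let ?P = "\<Prod>j=1..CARD('n)-m. ?g j u"
  \<comment> \<open>In the \<open>m\<close>-th power \<open>?P\<close> and every repeated
    \<open>?g\<close> occur \<open>m\<close> times. Regrouped, the \<open>i\<close>-th factor is the
    value at \<open>u\<close> of the product whose supremum is the \<open>i\<close>-th term on the
    right.\<close>
  have "mixed_affine_surface_area_neg_n K ^ m = (\<Prod>i=0..<m. ?P * ?g (CARD('n) - i) u ^ m)"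
    unfolding u(2) prod_last[OF m] by (simp add: prod.distrib power_mult_distrib prod_power_distrib)
  also have "\<dots> \<le> (\<Prod>i=0..<m. mixed_affine_surface_area_neg_n (replace_last m i))"
  proof (intro prod_mono conjI)
    fix i assume i: "i \<in> {0..<m}"
    show "0 \<le> ?P * ?g (CARD('n) - i) u ^ m"
      by (intro mult_nonneg_nonneg prod_nonneg zero_le_power neg_n_density_nonneg)
    have "continuous_on (sphere 0 1) (\<lambda>u. \<Prod>j=1..CARD('n). neg_n_density (replace_last m i j) u)"
      unfolding density_replace_last[OF m]
      by (intro continuous_intros continuous_density) (use i m in auto)
    then obtain w where "(SUP u\<in>sphere 0 1. \<Prod>j=1..CARD('n). neg_n_density (replace_last m i j) u)
        = (\<Prod>j=1..CARD('n). neg_n_density (replace_last m i j) w)"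
      "\<forall>y\<in>sphere 0 1. (\<Prod>j=1..CARD('n). neg_n_density (replace_last m i j) y)
        \<le> (\<Prod>j=1..CARD('n). neg_n_density (replace_last m i j) w)"
      by (rule compact_attains_SUP[OF compact_sphere sphere_nonempty])
    with u(1) show "?P * ?g (CARD('n) - i) u ^ m \<le> mixed_affine_surface_area_neg_n (replace_last m i)"
      unfolding mixed_neg_n_density density_replace_last[OF m, symmetric] by simp
  qed
  finally show ?thesis .
qed

text \<open>All products are multiples of a single function \<open>Q\<close> with supremum
  \<open>Z\<close>. Both sides come out as the product of the \<open>c i ^ m\<close> times
  \<open>Z ^ m\<close>.\<close>

lemma mixed_power_eq_dilates:
  assumes m: "1 \<le> m" "m \<le> CARD('n)"
    and dil: "\<And>j. j \<in> {CARD('n)-m+1..CARD('n)} \<Longrightarrow> dilates (K j) (K CARD('n))"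
  shows "mixed_affine_surface_area_neg_n K ^ m
    = (\<Prod>i=0..<m. mixed_affine_surface_area_neg_n (replace_last m i))"
proof -
  let ?n = "CARD('n)"
  have n: "?n \<in> {1..?n}" using m by auto
  have "\<exists>c. c > 0 \<and> K (?n - i) = (\<lambda>x. c *\<^sub>R x) ` K ?n" if "i < m" for i
    using dil[of "?n - i"] that m by (auto simp: dilates_def)
  then obtain c where c: "\<And>i. i < m \<Longrightarrow> c i > 0 \<and> K (?n - i) = (\<lambda>x. c i *\<^sub>R x) ` K ?n"
    by metis
  have g: "neg_n_density (K (?n - i)) u = c i * neg_n_density (K ?n) u"
    if "i < m" "u \<in> sphere 0 1" for i u
    using neg_n_density_dilate[OF C2[OF n] zero[OF n]] c[OF that(1)] that(2) by simp
  define Q where "Q = (\<lambda>u. (\<Prod>j=1..?n-m. neg_n_density (K j) u) * neg_n_density (K ?n) u ^ m)"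
  define Z where "Z = (SUP u\<in>sphere 0 1. Q u)"
  have cQ: "continuous_on (sphere 0 1) Q" unfolding Q_def
    by (intro continuous_intros continuous_density) (use n in auto)
  note SUP_Q = SUP_mult_left_compact[OF compact_sphere sphere_nonempty cQ, folded Z_def]
  have "mixed_affine_surface_area_neg_n K = (SUP u\<in>sphere 0 1. (\<Prod>i=0..<m. c i) * Q u)"
    unfolding mixed_neg_n_density prod_last[OF m(2)]
    by (intro SUP_cong refl) (simp add: Q_def g prod.distrib del: mem_sphere_0)
  also have "\<dots> = (\<Prod>i=0..<m. c i) * Z"
    by (rule SUP_Q, rule prod_nonneg) (use c in \<open>auto simp: less_imp_le\<close>)
  finally have L: "mixed_affine_surface_area_neg_n K = (\<Prod>i=0..<m. c i) * Z" .
  have R: "mixed_affine_surface_area_neg_n (replace_last m i) = c i ^ m * Z" if i: "i < m" for i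
  proof -
    have "mixed_affine_surface_area_neg_n (replace_last m i) = (SUP u\<in>sphere 0 1. c i ^ m * Q u)"
      unfolding mixed_neg_n_density density_replace_last[OF m(2)]
      by (intro SUP_cong refl) (simp add: Q_def g[OF i] power_mult_distrib del: mem_sphere_0)
    also have "\<dots> = c i ^ m * Z" by (rule SUP_Q) (use c[OF i] in auto)
    finally show ?thesis .
  qed
  show ?thesis
    unfolding L by (simp add: R prod.distrib power_mult_distrib prod_power_distrib)
qed

lemma mixed_power_le_prod:
  "mixed_affine_surface_area_neg_n K ^ CARD('n) \<le> (\<Prod>i=1..CARD('n). affine_surface_area_neg_n (K i))"
proof -
  \<comment> \<open>For \<open>m = CARD('n)\<close> the test in \<open>replace_last\<close> becomes
    \<open>j \<le> 0\<close>, which fails for every index in range, so all bodies are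
    replaced.\<close>
  have "mixed_affine_surface_area_neg_n (replace_last CARD('n) i)
      = affine_surface_area_neg_n (K (CARD('n) - i))" for i
    unfolding affine_surface_area_neg_n_def mixed_neg_n_density
    by (intro SUP_cong refl prod.cong) (auto simp: replace_last_def)
  moreover have "(\<Prod>i=1..CARD('n). affine_surface_area_neg_n (K i))
      = (\<Prod>i=0..<CARD('n). affine_surface_area_neg_n (K (CARD('n) - i)))"
    using prod_last[of "CARD('n)" "CARD('n)" "\<lambda>i. affine_surface_area_neg_n (K i)"] by simp
  ultimately show ?thesis using mixed_power_le[of "CARD('n)"] by simp
qed

section \<open>Comparison for different values of p\<close>

definition p_density :: "real \<Rightarrow> real^'n \<Rightarrow> real" where
  "p_density p u = (\<Prod>i=1..CARD('n). support_function (K i) u powr (1 - p) * curvature_function (K i) u)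
     powr (1 / (real CARD('n) + p))"

lemma mixed_density: "mixed_affine_surface_area p K = (LINT u|sphere_measure. p_density p u)"
  by (simp add: mixed_affine_surface_area_def p_density_def)

lemma positive:
  assumes "u \<in> sphere 0 1" "i \<in> {1..CARD('n)}"
  shows "support_function (K i) u > 0" "curvature_function (K i) u > 0"
  using assms support_function_pos[OF C2 zero] curvature_function_pos[OF C2] by auto

lemma continuous_on_p_density: "continuous_on (sphere 0 1) (p_density p)"
proof -
  have "(\<Prod>i=1..CARD('n). support_function (K i) u powr (1 - p) * curvature_function (K i) u) \<noteq> 0"
    if "u \<in> sphere 0 1" for u
    using positive[OF that] by (auto simp: less_imp_neq[symmetric] dest: less_imp_neq)
  thus ?thesis unfolding p_density_def[abs_def]
    by (intro continuous_intros continuous_on_support_function continuous_on_curvature_function C2)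
      (use positive in \<open>auto dest!: less_imp_neq\<close>)
qed

text \<open>Let e = 1/(n+p) - 1/(n+s) = (s-p)/((n+p)(n+s)). Because (1-q)/(n+q) = (n+1)/(n+q) - 1,
  passing from \<open>s\<close> to \<open>p\<close> raises the exponent of each f by e and that of
  each h by (n+1)e. As f h^(n+1) is the 2n-th power of g, the quotient is the power 2ne of the
  product of the g's.\<close>

lemma density_split:
  assumes u: "u \<in> sphere 0 1" and p: "p \<noteq> - real CARD('n)" and s: "s \<noteq> - real CARD('n)"
  shows "p_density p u = (\<Prod>i=1..CARD('n). neg_n_density (K i) u)
      powr (2 * real CARD('n) * (s - p) / ((real CARD('n) + p) * (real CARD('n) + s))) * p_density s u"
proof -
  define n where "n = real CARD('n)"
  define e where "e = (s - p) / ((n + p) * (n + s))"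
  have n: "n > 0" by (simp add: n_def)
  have np: "n + p \<noteq> 0" and ns: "n + s \<noteq> 0" using p s by (auto simp: n_def)
  define h where "h = (\<lambda>i. support_function (K i) u)"
  define f where "f = (\<lambda>i. curvature_function (K i) u)"
  have hf: "support_function (K i) u = h i" "curvature_function (K i) u = f i" for i
    by (simp_all add: h_def f_def)
  have pos: "h i > 0" "f i > 0" if "i \<in> {1..CARD('n)}" for i
    using positive[OF u that] by (simp_all add: h_def f_def)
  have density_eq: "p_density q u = (\<Prod>i=1..CARD('n). h i powr ((1 - q) / (n + q)) * f i powr (1 / (n + q)))" for q
    unfolding p_density_def hf n_def[symmetric]
    using pos by (subst prod_powr_distrib)
      (auto simp: powr_mult powr_powr less_imp_le intro!: prod.cong)
  have neg_eq: "(\<Prod>i=1..CARD('n). neg_n_density (K i) u) powr (2 * n * e)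
      = (\<Prod>i=1..CARD('n). f i powr e * h i powr ((n + 1) * e))"
    unfolding neg_n_density_def hf n_def[symmetric]
    using pos n by (subst prod_powr_distrib)
      (auto simp: powr_mult powr_powr less_imp_le intro!: prod.cong)
  have e1: "1 / (n + p) = e + 1 / (n + s)"
    using np ns by (simp add: e_def divide_simps)
  have e2: "(1 - p) / (n + p) = (n + 1) * e + (1 - s) / (n + s)"
    using np ns by (simp add: e_def divide_simps) (simp add: algebra_simps)
  have "p_density p u = (\<Prod>i=1..CARD('n). (f i powr e * h i powr ((n + 1) * e))
      * (h i powr ((1 - s) / (n + s)) * f i powr (1 / (n + s))))"
    unfolding density_eq e1 e2 by (intro prod.cong refl) (simp add: powr_add)
  also have "\<dots> = (\<Prod>i=1..CARD('n). neg_n_density (K i) u) powr (2 * n * e) * p_density s u"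
    unfolding neg_eq density_eq prod.distrib by (simp add: mult_ac)
  finally show ?thesis by (simp add: e_def n_def)
qed

lemma neg_n_density_prod_pos:
  "u \<in> sphere 0 1 \<Longrightarrow> (\<Prod>i=1..CARD('n). neg_n_density (K i) u) > 0"
  unfolding neg_n_density_def
  by (intro prod_pos mult_pos_pos ballI)
    (simp_all only: powr_gt_zero positive less_imp_neq[symmetric] not_False_eq_True simp_thms)

lemma neg_n_density_prod_le:
  assumes "u \<in> sphere 0 1"
  shows "(\<Prod>i=1..CARD('n). neg_n_density (K i) u) \<le> mixed_affine_surface_area_neg_n K"
proof -
  have "continuous_on (sphere 0 1) (\<lambda>u. \<Prod>i=1..CARD('n). neg_n_density (K i) u)"
    by (intro continuous_intros continuous_density)
  from compact_attains_SUP[OF compact_sphere sphere_nonempty this]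
  show ?thesis using assms unfolding mixed_neg_n_density by metis
qed

lemma mixed_comparison:
  fixes p s :: real
  assumes p: "p \<noteq> - real CARD('n)" and s: "s \<noteq> - real CARD('n)"
  defines "a \<equiv> 2 * real CARD('n) * (s - p) / ((real CARD('n) + p) * (real CARD('n) + s))"
  shows "a \<ge> 0 \<Longrightarrow> mixed_affine_surface_area p K
      \<le> mixed_affine_surface_area_neg_n K powr a * mixed_affine_surface_area s K"
    and "a \<le> 0 \<Longrightarrow> mixed_affine_surface_area p K
      \<ge> mixed_affine_surface_area_neg_n K powr a * mixed_affine_surface_area s K"
proof -
  let ?A = "mixed_affine_surface_area_neg_n K"
  let ?g = "\<lambda>u. \<Prod>i=1..CARD('n). neg_n_density (K i) u"
  have dp: "p_density p u = ?g u powr a * p_density s u" if "u \<in> sphere 0 1" for u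
    unfolding a_def by (rule density_split[OF that p s])
  have nn: "p_density s u \<ge> 0" for u by (simp add: p_density_def)
  have ip: "integrable sphere_measure (p_density p)" and is': "integrable sphere_measure (p_density s)"
    by (intro integrable_sphere_measure continuous_on_p_density)+
  have R: "?A powr a * mixed_affine_surface_area s K = (LINT u|sphere_measure. ?A powr a * p_density s u)"
    by (simp add: mixed_density)
  show "mixed_affine_surface_area p K \<le> ?A powr a * mixed_affine_surface_area s K" if "a \<ge> 0"
    unfolding R mixed_density[of p]
  proof (rule integral_mono[OF ip integrable_mult_right[OF is']])
    fix u assume "u \<in> space (sphere_measure :: (real^'n) measure)"
    hence u: "u \<in> sphere 0 1" by (simp only: space_sphere_measure)
    have "?g u powr a \<le> ?A powr a"
      using neg_n_density_prod_le[OF u] neg_n_density_prod_pos[OF u] that by (intro powr_mono2) auto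
    thus "p_density p u \<le> ?A powr a * p_density s u"
      unfolding dp[OF u] using nn by (rule mult_right_mono)
  qed
  show "mixed_affine_surface_area p K \<ge> ?A powr a * mixed_affine_surface_area s K" if "a \<le> 0"
    unfolding R mixed_density[of p]
  proof (rule integral_mono[OF integrable_mult_right[OF is'] ip])
    fix u assume "u \<in> space (sphere_measure :: (real^'n) measure)"
    hence u: "u \<in> sphere 0 1" by (simp only: space_sphere_measure)
    \<comment> \<open>A nonpositive exponent reverses the order between positive bases, hence the
      strict positivity of the product.\<close>
    have "?A powr a \<le> ?g u powr a"
      using neg_n_density_prod_le[OF u] neg_n_density_prod_pos[OF u] that by (intro powr_mono2') auto
    thus "?A powr a * p_density s u \<le> p_density p u"
      unfolding dp[OF u] using nn by (rule mult_right_mono)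
  qed
qed

end

theorem proposition2p6:
  fixes K :: "nat \<Rightarrow> (real^'n) set" and p s :: real
  defines "n \<equiv> CARD('n)"
  assumes "\<And>i. i \<in> {1..n} \<Longrightarrow> C2_plus (K i)"
    and "\<And>i. i \<in> {1..n} \<Longrightarrow> centroid (K i) = 0"
    and "p \<noteq> - real n" and "s \<noteq> - real n"
  shows
    "(\<forall>T :: real^'n \<Rightarrow> real^'n. linear T \<and> bij T \<longrightarrow>
        mixed_affine_surface_area_neg_n (\<lambda>i. T ` K i)
          = \<bar>det (matrix T)\<bar> * mixed_affine_surface_area_neg_n K \<and>
        (\<bar>det (matrix T)\<bar> = 1 \<longrightarrow>
          mixed_affine_surface_area_neg_n (\<lambda>i. T ` K i) = mixed_affine_surface_area_neg_n K))
   \<and> (\<forall>m::nat. 1 \<le> m \<and> m \<le> n \<longrightarrow>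
        mixed_affine_surface_area_neg_n K ^ m
          \<le> (\<Prod>i=0..<m. mixed_affine_surface_area_neg_n (\<lambda>j. if j \<le> n - m then K j else K (n - i))) \<and>
        ((\<forall>j\<in>{n-m+1..n}. \<forall>k\<in>{n-m+1..n}. dilates (K j) (K k)) \<longrightarrow>
          mixed_affine_surface_area_neg_n K ^ m
            = (\<Prod>i=0..<m. mixed_affine_surface_area_neg_n (\<lambda>j. if j \<le> n - m then K j else K (n - i)))))
   \<and> mixed_affine_surface_area_neg_n K ^ n \<le> (\<Prod>i=1..n. affine_surface_area_neg_n (K i))
   \<and> (real n * (s - p) / ((real n + p) * (real n + s)) \<ge> 0 \<longrightarrow>
        mixed_affine_surface_area p K
          \<le> mixed_affine_surface_area_neg_n K powr (2 * real n * (s - p) / ((real n + p) * (real n + s)))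
             * mixed_affine_surface_area s K)
   \<and> (real n * (s - p) / ((real n + p) * (real n + s)) \<le> 0 \<longrightarrow>
        mixed_affine_surface_area p K
          \<ge> mixed_affine_surface_area_neg_n K powr (2 * real n * (s - p) / ((real n + p) * (real n + s)))
             * mixed_affine_surface_area s K)"
proof -
  have K: "C2_plus (K i)" "0 \<in> interior (K i)" if "i \<in> {1..CARD('n)}" for i
    using that assms interior_centroid_zero by (auto simp: C2_plus_def)
  interpret centered_C2_plus_bodies K
    by (rule centered_C2_plus_bodies.intro) (fact K)+
  note comparison = mixed_comparison[OF assms(4,5)[unfolded n_def], folded n_def]
  \<comment> \<open>The sign conditions are stated for half of the exponent.\<close>
  have sgn: "2 * real n * (s - p) / ((real n + p) * (real n + s))
      = 2 * (real n * (s - p) / ((real n + p) * (real n + s)))" by simp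
  show ?thesis
  proof (intro conjI allI impI)
    fix T :: "real^'n \<Rightarrow> real^'n" assume T: "linear T \<and> bij T"
    show *: "mixed_affine_surface_area_neg_n (\<lambda>i. T ` K i)
          = \<bar>det (matrix T)\<bar> * mixed_affine_surface_area_neg_n K"
      using mixed_linear_image T by blast
    show "mixed_affine_surface_area_neg_n (\<lambda>i. T ` K i) = mixed_affine_surface_area_neg_n K"
      if "\<bar>det (matrix T)\<bar> = 1"
      using * that by simp
  next
    fix m assume m: "1 \<le> m \<and> m \<le> n"
    show "mixed_affine_surface_area_neg_n K ^ m
          \<le> (\<Prod>i=0..<m. mixed_affine_surface_area_neg_n (\<lambda>j. if j \<le> n - m then K j else K (n - i)))"
      using mixed_power_le[of m] m unfolding n_def replace_last_def by blast
    assume "\<forall>j\<in>{n-m+1..n}. \<forall>k\<in>{n-m+1..n}. dilates (K j) (K k)"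
    \<comment> \<open>The last body serves as the reference of which the others are dilates.\<close>
    moreover have "n \<in> {n-m+1..n}" using m by auto
    ultimately show "mixed_affine_surface_area_neg_n K ^ m
            = (\<Prod>i=0..<m. mixed_affine_surface_area_neg_n (\<lambda>j. if j \<le> n - m then K j else K (n - i)))"
      using mixed_power_eq_dilates[of m] m unfolding n_def replace_last_def by blast
  next
    show "mixed_affine_surface_area_neg_n K ^ n \<le> (\<Prod>i=1..n. affine_surface_area_neg_n (K i))"
      unfolding n_def by (rule mixed_power_le_prod)
  next
    assume "real n * (s - p) / ((real n + p) * (real n + s)) \<ge> 0"
    hence "2 * real n * (s - p) / ((real n + p) * (real n + s)) \<ge> 0" unfolding sgn by linarith
    thus "mixed_affine_surface_area p K
          \<le> mixed_affine_surface_area_neg_n K powr (2 * real n * (s - p) / ((real n + p) * (real n + s)))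
             * mixed_affine_surface_area s K"
      by (rule comparison(1))
  next
    assume "real n * (s - p) / ((real n + p) * (real n + s)) \<le> 0"
    hence "2 * real n * (s - p) / ((real n + p) * (real n + s)) \<le> 0" unfolding sgn by linarith
    thus "mixed_affine_surface_area p K
          \<ge> mixed_affine_surface_area_neg_n K powr (2 * real n * (s - p) / ((real n + p) * (real n + s)))
             * mixed_affine_surface_area s K"
      by (rule comparison(2))
  qed
qed

end
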